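(* Let $A$ be a type in a context extended by a fresh bridge variable $\mathbf{x}$, let $B$ be a type family over $a:A$ in that context, and let $F:\Pi_{a:A[\mathbf{0}/\mathbf{x}]}B[\mathbf{0}/\mathbf{x}]$ and $F':\Pi_{a:A[\mathbf{1}/\mathbf{x}]}B[\mathbf{1}/\mathbf{x}]$. Then there is an equivalence \[ \mathsf{Bridge}_{\mathbf{x}.\Pi_{a:A}B}(F,F')\simeq \Pi_{a:A[\mathbf{0}/\mathbf{x}]}\Pi_{a':A[\mathbf{1}/\mathbf{x}]}\Pi_{c:\mathsf{Bridge}_{\mathbf{x}.A}(a,a')}\mathsf{Bridge}_{\mathbf{x}.B[c\,\mathbf{x}/a]}(F\,a,F'\,a'). \]
   Context: We work in parametric cubical type theory: Martin-Löf type theory with $\Sigma$-, $\Pi$-types (with $\eta$) and a universe of Kan types, extended by path dimensions (structural) with path types and Kan operations, so paths behave like identity types of homotopy type theory (equivalences $\simeq$ defined as there), and by bridge dimensions (substructural: weakening and exchange but no contraction; variables $\mathbf{x},\mathbf{y},\dots$, constants $\mathbf{0},\mathbf{1}$). For $A$ depending on a fresh bridge variable $\mathbf{x}$ and $M_{\boldsymbol\varepsilon}:A[\boldsymbol\varepsilon/\mathbf{x}]$, $\mathsf{Bridge}_{\mathbf{x}.A}(M_{\mathbf{0}},M_{\mathbf{1}})$ has elements $\lambda^{\mathbf{x}}P$ with $P[\boldsymbol\varepsilon/\mathbf{x}]=M_{\boldsymbol\varepsilon}$, application $Q\,\mathbf{r}$ allowed only when $\mathbf{r}$ does not occur in $Q$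 (nor in the term variables $Q$ may depend on), with $\beta$, endpoint rules $Q\,\boldsymbol\varepsilon=M_{\boldsymbol\varepsilon}$, and $\eta$. The theory has an $\mathsf{extent}$ operator: given a bridge dimension $\mathbf{r}$, types $A$ and $B(d)$ ($d:A$) not mentioning $\mathbf{r}$ but depending on a fresh $\mathbf{x}$, $M:A[\mathbf{r}/\mathbf{x}]$, and (not mentioning $\mathbf{r}$) $N$ over $a:A[\mathbf{0}/\mathbf{x}]$ of type $B[\mathbf{0}/\mathbf{x}][a/d]$, $P$ over $a':A[\mathbf{1}/\mathbf{x}]$ of type $B[\mathbf{1}/\mathbf{x}][a'/d]$, and $Q$ over $a,a',c:\mathsf{Bridge}_{\mathbf{x}.A}(a,a')$ of type $\mathsf{Bridge}_{\mathbf{x}.B[c\,\mathbf{x}/d]}(N,P)$, one has $\mathsf{extent}_{\mathbf{r}}(M;a.N;a'.P;a.a'.c.Q):B[\mathbf{r}/\mathbf{x}][M/d]$, equal to $N[M/a]$ when $\mathbf{r}=\mathbf{0}$, to $P[M/a']$ when $\mathbf{r}=\mathbf{1}$, and $\mathsf{extent}_{\mathbf{r}}(M[\mathbf{r}/\mathbf{x}];\dots)=Q[M[\mathbf{0}/\mathbf{x}]/a,M[\mathbf{1}/\mathbf{x}]/a',\lambda^{\mathbf{x}}M/c]\,\mathbf{r}$, together with an $\eta$-rule. *)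

theory Defs
  imports Main
begin

section \<open>Raw syntax\<close>

text \<open>
  Raw expressions (types, terms and dimension expressions alike) are second-order syntax with de
  Bruijn indices: an argument \<open>(k, t)\<close> of an operator is an expression \<open>t\<close> in which \<open>k\<close> further
  variables are bound, the last one having index 0.  Term variables, path dimension variables,
  bridge dimension variables share one index space; the context says which sort an index has.
  \<open>Other c\<close> leaves room for operators besides the ones listed (see the extension parameter of the
  derivability relation below).
\<close>

datatype endpoint = E0 | E1

datatype 'c oper =
    PEndOp endpoint | BEndOp endpoint
  | UnivOp
  | PiOp | LamOp | AppOp
  | SigOp | PairOp | FstOp | SndOp
  | PathOp | PLamOp | PAppOp
  | BridgeOp | BLamOp | BAppOp
  | CoeOp | HcomOp
  | ExtentOp
  | Other 'c

datatype 'c tm = Var nat | Op "'c oper" "(nat \<times> 'c tm) list"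

definition upr :: "(nat \<Rightarrow> nat) \<Rightarrow> nat \<Rightarrow> nat" where
  "upr \<rho> n = (case n of 0 \<Rightarrow> 0 | Suc m \<Rightarrow> Suc (\<rho> m))"

fun ren :: "(nat \<Rightarrow> nat) \<Rightarrow> 'c tm \<Rightarrow> 'c tm" where
  "ren \<rho> (Var n) = Var (\<rho> n)"
| "ren \<rho> (Op f ts) = Op f (map (\<lambda>(k, t). (k, ren ((upr ^^ k) \<rho>) t)) ts)"

abbreviation wk :: "nat \<Rightarrow> 'c tm \<Rightarrow> 'c tm" where
  "wk k \<equiv> ren (\<lambda>n. n + k)"

definition scons :: "'c tm \<Rightarrow> (nat \<Rightarrow> 'c tm) \<Rightarrow> nat \<Rightarrow> 'c tm" (infixr ".:" 65) where
  "(t .: \<sigma>) n = (case n of 0 \<Rightarrow> t | Suc m \<Rightarrow> \<sigma> m)"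

definition up :: "(nat \<Rightarrow> 'c tm) \<Rightarrow> nat \<Rightarrow> 'c tm" where
  "up \<sigma> = Var 0 .: (\<lambda>n. wk 1 (\<sigma> n))"

fun tsubst :: "(nat \<Rightarrow> 'c tm) \<Rightarrow> 'c tm \<Rightarrow> 'c tm" where
  "tsubst \<sigma> (Var n) = \<sigma> n"
| "tsubst \<sigma> (Op f ts) = Op f (map (\<lambda>(k, t). (k, tsubst ((up ^^ k) \<sigma>) t)) ts)"

text \<open>
  \<open>inst t s\<close> is $t[s/x_0]$; \<open>inst_under t s\<close> is $t[s/x_1]$, where $s$ does not mention $x_0$;
  \<open>inst2 t s u\<close> is $t[s/x_1][u/x_0]$.
\<close>

definition inst :: "'c tm \<Rightarrow> 'c tm \<Rightarrow> 'c tm" where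
  "inst t s = tsubst (s .: Var) t"

definition inst_under :: "'c tm \<Rightarrow> 'c tm \<Rightarrow> 'c tm" where
  "inst_under t s = tsubst (up (s .: Var)) t"

definition inst2 :: "'c tm \<Rightarrow> 'c tm \<Rightarrow> 'c tm \<Rightarrow> 'c tm" where
  "inst2 t s u = tsubst (u .: s .: Var) t"

abbreviation "PEnd \<epsilon> \<equiv> Op (PEndOp \<epsilon>) []"
abbreviation "BEnd \<epsilon> \<equiv> Op (BEndOp \<epsilon>) []"
abbreviation "Univ \<equiv> Op UnivOp []"
abbreviation "Pi A B \<equiv> Op PiOp [(0, A), (1, B)]"
abbreviation "Lam t \<equiv> Op LamOp [(1, t)]"
abbreviation "App t s \<equiv> Op AppOp [(0, t), (0, s)]"
abbreviation "Sig A B \<equiv> Op SigOp [(0, A), (1, B)]"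
abbreviation "Tup t s \<equiv> Op PairOp [(0, t), (0, s)]"
abbreviation "Fst t \<equiv> Op FstOp [(0, t)]"
abbreviation "Snd t \<equiv> Op SndOp [(0, t)]"
abbreviation "Path A t s \<equiv> Op PathOp [(1, A), (0, t), (0, s)]"
abbreviation "PLam t \<equiv> Op PLamOp [(1, t)]"
abbreviation "PApp t r \<equiv> Op PAppOp [(0, t), (0, r)]"
abbreviation "Bridge A t s \<equiv> Op BridgeOp [(1, A), (0, t), (0, s)]"
abbreviation "BLam t \<equiv> Op BLamOp [(1, t)]"
abbreviation "BApp t r \<equiv> Op BAppOp [(0, t), (0, r)]"
abbreviation "Coe A r s t \<equiv> Op CoeOp [(1, A), (0, r), (0, s), (0, t)]"
abbreviation "Extent r M N P Q \<equiv> Op ExtentOp [(0, r), (0, M), (1, N), (1, P), (3, Q)]"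

text \<open>
  In a homogeneous composition from \<open>r\<close> to \<open>s\<close> with cap \<open>M\<close>, a tube \<open>(u, v, N)\<close> consists of a
  constraint \<open>u = v\<close> and of a term \<open>N\<close> that binds a path dimension.
\<close>

definition Hcom :: "'c tm \<Rightarrow> 'c tm \<Rightarrow> 'c tm \<Rightarrow> 'c tm \<Rightarrow> ('c tm \<times> 'c tm \<times> 'c tm) list \<Rightarrow> 'c tm" where
  "Hcom A r s M ts =
     Op HcomOp ([(0, A), (0, r), (0, s), (0, M)] @ concat (map (\<lambda>(u, v, N). [(0, u), (0, v), (1, N)]) ts))"

section \<open>Contexts and dimensions\<close>

text \<open>
  The most recent entry is at the head; an entry refers to the tail behind it.  A constraint entry
  \<open>CEq r s\<close> (the assumption \<open>r = s\<close>) occupies an index that no expression uses.  An entry \<open>Hidden\<close>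
  marks an index that must not be used; it arises from \<open>apart\<close> below.
\<close>

datatype 'c entry = CTm "'c tm" | CPath | CBridge | CEq "'c tm" "'c tm" | Hidden

type_synonym 'c ctx = "'c entry list"

text \<open>
  \<open>apart \<Gamma> r\<close> is the part of \<open>\<Gamma>\<close> available to an expression that has to be apart from the bridge
  dimension \<open>r\<close>: if \<open>r\<close> is a variable, then \<open>r\<close> itself, the term variables declared after it
  (for which an expression mentioning \<open>r\<close> may be substituted) and the constraints on it are
  withdrawn.  Withdrawn entries are hidden instead of deleted, so indices do not change.
\<close>

fun hide :: "'c ctx \<Rightarrow> nat \<Rightarrow> 'c ctx" where
  "hide [] n = []"
| "hide (e # \<Gamma>) 0 = Hidden # \<Gamma>"
| "hide (e # \<Gamma>) (Suc n) =
     (case e of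
        CTm A \<Rightarrow> Hidden
      | CEq r s \<Rightarrow> (if r = Var n \<or> s = Var n then Hidden else CEq r s)
      | _ \<Rightarrow> e) # hide \<Gamma> n"

fun apart :: "'c ctx \<Rightarrow> 'c tm \<Rightarrow> 'c ctx" where
  "apart \<Gamma> (Var n) = hide \<Gamma> n"
| "apart \<Gamma> (Op f ts) = \<Gamma>"

definition pdim :: "'c ctx \<Rightarrow> 'c tm \<Rightarrow> bool" where
  "pdim \<Gamma> r \<longleftrightarrow> (\<exists>\<epsilon>. r = PEnd \<epsilon>) \<or> (\<exists>n < length \<Gamma>. r = Var n \<and> \<Gamma> ! n = CPath)"

definition bdim :: "'c ctx \<Rightarrow> 'c tm \<Rightarrow> bool" where
  "bdim \<Gamma> r \<longleftrightarrow> (\<exists>\<epsilon>. r = BEnd \<epsilon>) \<or> (\<exists>n < length \<Gamma>. r = Var n \<and> \<Gamma> ! n = CBridge)"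

text \<open>
  Constraints equate path dimensions with each other, and bridge dimensions with endpoints only.
\<close>

definition constraint :: "'c ctx \<Rightarrow> 'c tm \<Rightarrow> 'c tm \<Rightarrow> bool" where
  "constraint \<Gamma> u v \<longleftrightarrow> (pdim \<Gamma> u \<and> pdim \<Gamma> v) \<or> (bdim \<Gamma> u \<and> (\<exists>\<epsilon>. v = BEnd \<epsilon>))"

inductive dimeq :: "'c ctx \<Rightarrow> 'c tm \<Rightarrow> 'c tm \<Rightarrow> bool" for \<Gamma> where
  dimeq_refl: "pdim \<Gamma> r \<or> bdim \<Gamma> r \<Longrightarrow> dimeq \<Gamma> r r"
| dimeq_hyp: "n < length \<Gamma> \<Longrightarrow> \<Gamma> ! n = CEq r s \<Longrightarrow> dimeq \<Gamma> (wk (Suc n) r) (wk (Suc n) s)"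
| dimeq_sym: "dimeq \<Gamma> r s \<Longrightarrow> dimeq \<Gamma> s r"
| dimeq_trans: "dimeq \<Gamma> r s \<Longrightarrow> dimeq \<Gamma> s t \<Longrightarrow> dimeq \<Gamma> r t"

definition absurd :: "'c ctx \<Rightarrow> bool" where
  "absurd \<Gamma> \<longleftrightarrow> dimeq \<Gamma> (PEnd E0) (PEnd E1) \<or> dimeq \<Gamma> (BEnd E0) (BEnd E1)"

section \<open>Judgments\<close>

text \<open>
  \<open>IsTy Large A\<close> is the judgment that \<open>A\<close> is a type; the small types are the elements of the
  universe (a la Russell).
\<close>

datatype size = Small | Large

datatype 'c jdg =
    IsTy size "'c tm"
  | EqTy size "'c tm" "'c tm"
  | HasTm "'c tm" "'c tm"
  | EqTm "'c tm" "'c tm" "'c tm"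

fun jsubst :: "(nat \<Rightarrow> 'c tm) \<Rightarrow> 'c jdg \<Rightarrow> 'c jdg" where
  "jsubst \<sigma> (IsTy l A) = IsTy l (tsubst \<sigma> A)"
| "jsubst \<sigma> (EqTy l A B) = EqTy l (tsubst \<sigma> A) (tsubst \<sigma> B)"
| "jsubst \<sigma> (HasTm M A) = HasTm (tsubst \<sigma> M) (tsubst \<sigma> A)"
| "jsubst \<sigma> (EqTm M N A) = EqTm (tsubst \<sigma> M) (tsubst \<sigma> N) (tsubst \<sigma> A)"

text \<open>
  Let \<open>A\<close> live over \<open>\<Gamma>, x\<close> and \<open>t\<close> over \<open>\<Gamma>, x, d : A\<close>, with \<open>x\<close> a bridge variable.
  \<open>edge A\<close> is the type $\mathsf{Bridge}_{x.A}(a,a')$ over $\Gamma, a : A[0/x], a' : A[1/x]$,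
  and \<open>along t\<close> is $t[c\,x/d]$ over $\Gamma, a, a', c : \mathsf{Bridge}_{x.A}(a,a'), x$.
\<close>

definition edge :: "'c tm \<Rightarrow> 'c tm" where
  "edge A = Bridge (ren (upr (\<lambda>n. n + 2)) A) (Var 1) (Var 0)"

definition along :: "'c tm \<Rightarrow> 'c tm" where
  "along t = tsubst (BApp (Var 1) (Var 0) .: Var 0 .: (\<lambda>n. Var (n + 4))) t"

text \<open>
  The premises of \<open>Extent r M N P Q\<close> other than those on \<open>r\<close> and \<open>M\<close>; here \<open>\<Delta>\<close> is the context
  apart from \<open>r\<close>.
\<close>

definition extent_premises ::
  "'c ctx \<Rightarrow> 'c tm \<Rightarrow> 'c tm \<Rightarrow> 'c tm \<Rightarrow> 'c tm \<Rightarrow> 'c tm \<Rightarrow> ('c ctx \<times> 'c jdg) set" where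
  "extent_premises \<Delta> A B N P Q =
    {(CBridge # \<Delta>, IsTy Large A),
     (CTm A # CBridge # \<Delta>, IsTy Large B),
     (CTm (inst A (BEnd E0)) # \<Delta>, HasTm N (inst_under B (BEnd E0))),
     (CTm (inst A (BEnd E1)) # \<Delta>, HasTm P (inst_under B (BEnd E1))),
     (CTm (edge A) # CTm (wk 1 (inst A (BEnd E1))) # CTm (inst A (BEnd E0)) # \<Delta>,
      HasTm Q (Bridge (along B)
                (tsubst (Var 2 .: (\<lambda>n. Var (n + 3))) N)
                (tsubst (Var 1 .: (\<lambda>n. Var (n + 3))) P)))}"

text \<open>
  The premises of a composition: every tube has type \<open>A\<close> under its constraint, agrees with the cap
  at \<open>r\<close>, and any two tubes agree where both constraints hold.
\<close>

definition hcom_premises ::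
  "'c ctx \<Rightarrow> 'c tm \<Rightarrow> 'c tm \<Rightarrow> 'c tm \<Rightarrow> ('c tm \<times> 'c tm \<times> 'c tm) list \<Rightarrow> ('c ctx \<times> 'c jdg) set" where
  "hcom_premises \<Gamma> A r M ts =
    {(\<Gamma>, IsTy Large A), (\<Gamma>, HasTm M A)} \<union>
    (\<Union>(u, v, N) \<in> set ts.
      {(CEq (wk 1 u) (wk 1 v) # CPath # \<Gamma>, HasTm (wk 1 N) (wk 2 A)),
       (CEq u v # \<Gamma>, EqTm (wk 1 (inst N r)) (wk 1 M) (wk 1 A))}) \<union>
    (\<Union>(u, v, N) \<in> set ts. \<Union>(u', v', N') \<in> set ts.
      {(CEq (wk 2 u') (wk 2 v') # CEq (wk 1 u) (wk 1 v) # CPath # \<Gamma>,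
        EqTm (wk 2 N) (wk 2 N') (wk 3 A))})"

section \<open>Derivability\<close>

text \<open>
  The parameter \<open>R\<close> is an arbitrary set of additional rules, each given by a set of premises and a
  conclusion.  With \<open>R = {}\<close> one gets the theory with just the constructs listed here; other choices
  add, for instance, the computation rules of the Kan operations at the individual type formers,
  univalence, or further type formers.

  There is one notion of type, and every type has the Kan operations \<open>Coe\<close> and \<open>Hcom\<close>.

  \<open>wf_sub R \<Delta> \<sigma> \<Gamma>\<close> says that \<open>\<sigma>\<close> is a substitution from \<open>\<Delta>\<close> to \<open>\<Gamma>\<close>.  Weakening, exchange and
  substitution are all instances of the rule \<open>substitution\<close>.  In the rule \<open>sub_bridge\<close>, everything
  declared before a bridge variable must be interpreted apart from the image of this variable;
  this excludes contraction of bridge variables.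
\<close>

inductive
  wf_ctx :: "(('c ctx \<times> 'c jdg) set \<times> 'c ctx \<times> 'c jdg) set \<Rightarrow> 'c ctx \<Rightarrow> bool" and
  wf_sub :: "(('c ctx \<times> 'c jdg) set \<times> 'c ctx \<times> 'c jdg) set \<Rightarrow> 'c ctx \<Rightarrow> (nat \<Rightarrow> 'c tm) \<Rightarrow> 'c ctx \<Rightarrow> bool" and
  der :: "(('c ctx \<times> 'c jdg) set \<times> 'c ctx \<times> 'c jdg) set \<Rightarrow> 'c ctx \<Rightarrow> 'c jdg \<Rightarrow> bool"
    ("_ \<turnstile> _ \<rhd> _" [51, 51, 51] 50)
  for R
where
  \<comment> \<open>contexts\<close>
  ctx_nil: "wf_ctx R []"
| ctx_tm: "wf_ctx R \<Gamma> \<Longrightarrow> R \<turnstile> \<Gamma> \<rhd> IsTy Large A \<Longrightarrow> wf_ctx R (CTm A # \<Gamma>)"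
| ctx_path: "wf_ctx R \<Gamma> \<Longrightarrow> wf_ctx R (CPath # \<Gamma>)"
| ctx_bridge: "wf_ctx R \<Gamma> \<Longrightarrow> wf_ctx R (CBridge # \<Gamma>)"
| ctx_eq: "wf_ctx R \<Gamma> \<Longrightarrow> constraint \<Gamma> u v \<Longrightarrow> wf_ctx R (CEq u v # \<Gamma>)"
| ctx_hidden: "wf_ctx R \<Gamma> \<Longrightarrow> wf_ctx R (Hidden # \<Gamma>)"

  \<comment> \<open>substitutions\<close>
| sub_nil: "wf_ctx R \<Delta> \<Longrightarrow> wf_sub R \<Delta> \<sigma> []"
| sub_tm: "wf_sub R \<Delta> (\<lambda>n. \<sigma> (Suc n)) \<Gamma> \<Longrightarrow> R \<turnstile> \<Gamma> \<rhd> IsTy Large A \<Longrightarrow>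
    R \<turnstile> \<Delta> \<rhd> HasTm (\<sigma> 0) (tsubst (\<lambda>n. \<sigma> (Suc n)) A) \<Longrightarrow> wf_sub R \<Delta> \<sigma> (CTm A # \<Gamma>)"
| sub_path: "wf_sub R \<Delta> (\<lambda>n. \<sigma> (Suc n)) \<Gamma> \<Longrightarrow> pdim \<Delta> (\<sigma> 0) \<Longrightarrow> wf_sub R \<Delta> \<sigma> (CPath # \<Gamma>)"
| sub_bridge: "wf_ctx R \<Delta> \<Longrightarrow> bdim \<Delta> (\<sigma> 0) \<Longrightarrow> wf_sub R (apart \<Delta> (\<sigma> 0)) (\<lambda>n. \<sigma> (Suc n)) \<Gamma> \<Longrightarrow>
    wf_sub R \<Delta> \<sigma> (CBridge # \<Gamma>)"
| sub_eq: "wf_sub R \<Delta> (\<lambda>n. \<sigma> (Suc n)) \<Gamma> \<Longrightarrow> constraint \<Gamma> u v \<Longrightarrow>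
    dimeq \<Delta> (tsubst (\<lambda>n. \<sigma> (Suc n)) u) (tsubst (\<lambda>n. \<sigma> (Suc n)) v) \<Longrightarrow> wf_sub R \<Delta> \<sigma> (CEq u v # \<Gamma>)"
| sub_hidden: "wf_sub R \<Delta> (\<lambda>n. \<sigma> (Suc n)) \<Gamma> \<Longrightarrow> wf_sub R \<Delta> \<sigma> (Hidden # \<Gamma>)"

  \<comment> \<open>additional rules\<close>
| additional: "(\<J>, \<Gamma>, J) \<in> R \<Longrightarrow> \<forall>\<Delta> K. (\<Delta>, K) \<in> \<J> \<longrightarrow> R \<turnstile> \<Delta> \<rhd> K \<Longrightarrow> R \<turnstile> \<Gamma> \<rhd> J"

  \<comment> \<open>structural rules; substitutions that are equal (dimensions up to the constraints) act equally\<close>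
| variable: "wf_ctx R \<Gamma> \<Longrightarrow> n < length \<Gamma> \<Longrightarrow> \<Gamma> ! n = CTm A \<Longrightarrow> R \<turnstile> \<Gamma> \<rhd> HasTm (Var n) (wk (Suc n) A)"
| substitution: "wf_sub R \<Delta> \<sigma> \<Gamma> \<Longrightarrow> R \<turnstile> \<Gamma> \<rhd> J \<Longrightarrow> R \<turnstile> \<Delta> \<rhd> jsubst \<sigma> J"
| ty_subst_eq: "wf_sub R \<Delta> \<sigma> \<Gamma> \<Longrightarrow> wf_sub R \<Delta> \<tau> \<Gamma> \<Longrightarrow>
    \<forall>n A. n < length \<Gamma> \<longrightarrow> \<Gamma> ! n = CTm A \<longrightarrow> R \<turnstile> \<Delta> \<rhd> EqTm (\<sigma> n) (\<tau> n) (tsubst \<sigma> (wk (Suc n) A)) \<Longrightarrow>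
    \<forall>n. n < length \<Gamma> \<longrightarrow> \<Gamma> ! n = CPath \<or> \<Gamma> ! n = CBridge \<longrightarrow> dimeq \<Delta> (\<sigma> n) (\<tau> n) \<Longrightarrow>
    R \<turnstile> \<Gamma> \<rhd> IsTy l B \<Longrightarrow> R \<turnstile> \<Delta> \<rhd> EqTy l (tsubst \<sigma> B) (tsubst \<tau> B)"
| tm_subst_eq: "wf_sub R \<Delta> \<sigma> \<Gamma> \<Longrightarrow> wf_sub R \<Delta> \<tau> \<Gamma> \<Longrightarrow>
    \<forall>n A. n < length \<Gamma> \<longrightarrow> \<Gamma> ! n = CTm A \<longrightarrow> R \<turnstile> \<Delta> \<rhd> EqTm (\<sigma> n) (\<tau> n) (tsubst \<sigma> (wk (Suc n) A)) \<Longrightarrow>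
    \<forall>n. n < length \<Gamma> \<longrightarrow> \<Gamma> ! n = CPath \<or> \<Gamma> ! n = CBridge \<longrightarrow> dimeq \<Delta> (\<sigma> n) (\<tau> n) \<Longrightarrow>
    R \<turnstile> \<Gamma> \<rhd> HasTm M B \<Longrightarrow> R \<turnstile> \<Delta> \<rhd> EqTm (tsubst \<sigma> M) (tsubst \<tau> M) (tsubst \<sigma> B)"
| ty_absurd: "absurd \<Gamma> \<Longrightarrow> R \<turnstile> \<Gamma> \<rhd> IsTy l A \<Longrightarrow> R \<turnstile> \<Gamma> \<rhd> IsTy l B \<Longrightarrow> R \<turnstile> \<Gamma> \<rhd> EqTy l A B"
| tm_absurd: "absurd \<Gamma> \<Longrightarrow> R \<turnstile> \<Gamma> \<rhd> HasTm M A \<Longrightarrow> R \<turnstile> \<Gamma> \<rhd> HasTm N A \<Longrightarrow> R \<turnstile> \<Gamma> \<rhd> EqTm M N A"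

| ty_refl: "R \<turnstile> \<Gamma> \<rhd> IsTy l A \<Longrightarrow> R \<turnstile> \<Gamma> \<rhd> EqTy l A A"
| ty_sym: "R \<turnstile> \<Gamma> \<rhd> EqTy l A B \<Longrightarrow> R \<turnstile> \<Gamma> \<rhd> EqTy l B A"
| ty_trans: "R \<turnstile> \<Gamma> \<rhd> EqTy l A B \<Longrightarrow> R \<turnstile> \<Gamma> \<rhd> EqTy l B C \<Longrightarrow> R \<turnstile> \<Gamma> \<rhd> EqTy l A C"
| tm_refl: "R \<turnstile> \<Gamma> \<rhd> HasTm M A \<Longrightarrow> R \<turnstile> \<Gamma> \<rhd> EqTm M M A"
| tm_sym: "R \<turnstile> \<Gamma> \<rhd> EqTm M N A \<Longrightarrow> R \<turnstile> \<Gamma> \<rhd> EqTm N M A"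
| tm_trans: "R \<turnstile> \<Gamma> \<rhd> EqTm M N A \<Longrightarrow> R \<turnstile> \<Gamma> \<rhd> EqTm N P A \<Longrightarrow> R \<turnstile> \<Gamma> \<rhd> EqTm M P A"
| conv: "R \<turnstile> \<Gamma> \<rhd> HasTm M A \<Longrightarrow> R \<turnstile> \<Gamma> \<rhd> EqTy Large A B \<Longrightarrow> R \<turnstile> \<Gamma> \<rhd> HasTm M B"
| conv_eq: "R \<turnstile> \<Gamma> \<rhd> EqTm M N A \<Longrightarrow> R \<turnstile> \<Gamma> \<rhd> EqTy Large A B \<Longrightarrow> R \<turnstile> \<Gamma> \<rhd> EqTm M N B"

  \<comment> \<open>the universe\<close>
| univ_form: "wf_ctx R \<Gamma> \<Longrightarrow> R \<turnstile> \<Gamma> \<rhd> IsTy Large Univ"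
| univ_intro: "R \<turnstile> \<Gamma> \<rhd> IsTy Small A \<Longrightarrow> R \<turnstile> \<Gamma> \<rhd> HasTm A Univ"
| univ_elim: "R \<turnstile> \<Gamma> \<rhd> HasTm A Univ \<Longrightarrow> R \<turnstile> \<Gamma> \<rhd> IsTy Small A"
| univ_intro_eq: "R \<turnstile> \<Gamma> \<rhd> EqTy Small A B \<Longrightarrow> R \<turnstile> \<Gamma> \<rhd> EqTm A B Univ"
| univ_elim_eq: "R \<turnstile> \<Gamma> \<rhd> EqTm A B Univ \<Longrightarrow> R \<turnstile> \<Gamma> \<rhd> EqTy Small A B"
| small_large: "R \<turnstile> \<Gamma> \<rhd> IsTy Small A \<Longrightarrow> R \<turnstile> \<Gamma> \<rhd> IsTy Large A"
| small_large_eq: "R \<turnstile> \<Gamma> \<rhd> EqTy Small A B \<Longrightarrow> R \<turnstile> \<Gamma> \<rhd> EqTy Large A B"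

  \<comment> \<open>dependent functions\<close>
| pi_form: "R \<turnstile> \<Gamma> \<rhd> IsTy l A \<Longrightarrow> R \<turnstile> CTm A # \<Gamma> \<rhd> IsTy l B \<Longrightarrow> R \<turnstile> \<Gamma> \<rhd> IsTy l (Pi A B)"
| pi_form_eq: "R \<turnstile> \<Gamma> \<rhd> IsTy l A \<Longrightarrow> R \<turnstile> \<Gamma> \<rhd> EqTy l A A' \<Longrightarrow> R \<turnstile> CTm A # \<Gamma> \<rhd> EqTy l B B' \<Longrightarrow>
    R \<turnstile> \<Gamma> \<rhd> EqTy l (Pi A B) (Pi A' B')"
| lam: "R \<turnstile> \<Gamma> \<rhd> IsTy Large A \<Longrightarrow> R \<turnstile> CTm A # \<Gamma> \<rhd> HasTm M B \<Longrightarrow> R \<turnstile> \<Gamma> \<rhd> HasTm (Lam M) (Pi A B)"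
| lam_eq: "R \<turnstile> \<Gamma> \<rhd> IsTy Large A \<Longrightarrow> R \<turnstile> CTm A # \<Gamma> \<rhd> EqTm M M' B \<Longrightarrow>
    R \<turnstile> \<Gamma> \<rhd> EqTm (Lam M) (Lam M') (Pi A B)"
| app: "R \<turnstile> \<Gamma> \<rhd> HasTm M (Pi A B) \<Longrightarrow> R \<turnstile> \<Gamma> \<rhd> HasTm N A \<Longrightarrow> R \<turnstile> \<Gamma> \<rhd> HasTm (App M N) (inst B N)"
| app_eq: "R \<turnstile> \<Gamma> \<rhd> EqTm M M' (Pi A B) \<Longrightarrow> R \<turnstile> \<Gamma> \<rhd> EqTm N N' A \<Longrightarrow>
    R \<turnstile> \<Gamma> \<rhd> EqTm (App M N) (App M' N') (inst B N)"
| pi_beta: "R \<turnstile> \<Gamma> \<rhd> IsTy Large A \<Longrightarrow> R \<turnstile> CTm A # \<Gamma> \<rhd> HasTm M B \<Longrightarrow> R \<turnstile> \<Gamma> \<rhd> HasTm N A \<Longrightarrow>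
    R \<turnstile> \<Gamma> \<rhd> EqTm (App (Lam M) N) (inst M N) (inst B N)"
| pi_eta: "R \<turnstile> \<Gamma> \<rhd> HasTm M (Pi A B) \<Longrightarrow> R \<turnstile> \<Gamma> \<rhd> EqTm M (Lam (App (wk 1 M) (Var 0))) (Pi A B)"

  \<comment> \<open>dependent pairs\<close>
| sig_form: "R \<turnstile> \<Gamma> \<rhd> IsTy l A \<Longrightarrow> R \<turnstile> CTm A # \<Gamma> \<rhd> IsTy l B \<Longrightarrow> R \<turnstile> \<Gamma> \<rhd> IsTy l (Sig A B)"
| sig_form_eq: "R \<turnstile> \<Gamma> \<rhd> IsTy l A \<Longrightarrow> R \<turnstile> \<Gamma> \<rhd> EqTy l A A' \<Longrightarrow> R \<turnstile> CTm A # \<Gamma> \<rhd> EqTy l B B' \<Longrightarrow>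
    R \<turnstile> \<Gamma> \<rhd> EqTy l (Sig A B) (Sig A' B')"
| pair: "R \<turnstile> CTm A # \<Gamma> \<rhd> IsTy Large B \<Longrightarrow> R \<turnstile> \<Gamma> \<rhd> HasTm M A \<Longrightarrow> R \<turnstile> \<Gamma> \<rhd> HasTm N (inst B M) \<Longrightarrow>
    R \<turnstile> \<Gamma> \<rhd> HasTm (Tup M N) (Sig A B)"
| pair_eq: "R \<turnstile> CTm A # \<Gamma> \<rhd> IsTy Large B \<Longrightarrow> R \<turnstile> \<Gamma> \<rhd> EqTm M M' A \<Longrightarrow>
    R \<turnstile> \<Gamma> \<rhd> EqTm N N' (inst B M) \<Longrightarrow> R \<turnstile> \<Gamma> \<rhd> EqTm (Tup M N) (Tup M' N') (Sig A B)"
| fst: "R \<turnstile> \<Gamma> \<rhd> HasTm M (Sig A B) \<Longrightarrow> R \<turnstile> \<Gamma> \<rhd> HasTm (Fst M) A"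
| fst_eq: "R \<turnstile> \<Gamma> \<rhd> EqTm M M' (Sig A B) \<Longrightarrow> R \<turnstile> \<Gamma> \<rhd> EqTm (Fst M) (Fst M') A"
| snd: "R \<turnstile> \<Gamma> \<rhd> HasTm M (Sig A B) \<Longrightarrow> R \<turnstile> \<Gamma> \<rhd> HasTm (Snd M) (inst B (Fst M))"
| snd_eq: "R \<turnstile> \<Gamma> \<rhd> EqTm M M' (Sig A B) \<Longrightarrow> R \<turnstile> \<Gamma> \<rhd> EqTm (Snd M) (Snd M') (inst B (Fst M))"
| fst_beta: "R \<turnstile> CTm A # \<Gamma> \<rhd> IsTy Large B \<Longrightarrow> R \<turnstile> \<Gamma> \<rhd> HasTm M A \<Longrightarrow>
    R \<turnstile> \<Gamma> \<rhd> HasTm N (inst B M) \<Longrightarrow> R \<turnstile> \<Gamma> \<rhd> EqTm (Fst (Tup M N)) M A"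
| snd_beta: "R \<turnstile> CTm A # \<Gamma> \<rhd> IsTy Large B \<Longrightarrow> R \<turnstile> \<Gamma> \<rhd> HasTm M A \<Longrightarrow>
    R \<turnstile> \<Gamma> \<rhd> HasTm N (inst B M) \<Longrightarrow> R \<turnstile> \<Gamma> \<rhd> EqTm (Snd (Tup M N)) N (inst B M)"
| sig_eta: "R \<turnstile> \<Gamma> \<rhd> HasTm M (Sig A B) \<Longrightarrow> R \<turnstile> \<Gamma> \<rhd> EqTm M (Tup (Fst M) (Snd M)) (Sig A B)"

  \<comment> \<open>path types\<close>
| path_form: "R \<turnstile> CPath # \<Gamma> \<rhd> IsTy l A \<Longrightarrow> R \<turnstile> \<Gamma> \<rhd> HasTm M (inst A (PEnd E0)) \<Longrightarrow>
    R \<turnstile> \<Gamma> \<rhd> HasTm N (inst A (PEnd E1)) \<Longrightarrow> R \<turnstile> \<Gamma> \<rhd> IsTy l (Path A M N)"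
| path_form_eq: "R \<turnstile> CPath # \<Gamma> \<rhd> EqTy l A A' \<Longrightarrow> R \<turnstile> \<Gamma> \<rhd> EqTm M M' (inst A (PEnd E0)) \<Longrightarrow>
    R \<turnstile> \<Gamma> \<rhd> EqTm N N' (inst A (PEnd E1)) \<Longrightarrow> R \<turnstile> \<Gamma> \<rhd> EqTy l (Path A M N) (Path A' M' N')"
| plam: "R \<turnstile> CPath # \<Gamma> \<rhd> HasTm P A \<Longrightarrow> R \<turnstile> \<Gamma> \<rhd> EqTm (inst P (PEnd E0)) M (inst A (PEnd E0)) \<Longrightarrow>
    R \<turnstile> \<Gamma> \<rhd> EqTm (inst P (PEnd E1)) N (inst A (PEnd E1)) \<Longrightarrow> R \<turnstile> \<Gamma> \<rhd> HasTm (PLam P) (Path A M N)"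
| plam_eq: "R \<turnstile> CPath # \<Gamma> \<rhd> EqTm P P' A \<Longrightarrow> R \<turnstile> \<Gamma> \<rhd> EqTm (inst P (PEnd E0)) M (inst A (PEnd E0)) \<Longrightarrow>
    R \<turnstile> \<Gamma> \<rhd> EqTm (inst P (PEnd E1)) N (inst A (PEnd E1)) \<Longrightarrow>
    R \<turnstile> \<Gamma> \<rhd> EqTm (PLam P) (PLam P') (Path A M N)"
| papp: "R \<turnstile> \<Gamma> \<rhd> HasTm Q (Path A M N) \<Longrightarrow> pdim \<Gamma> r \<Longrightarrow> R \<turnstile> \<Gamma> \<rhd> HasTm (PApp Q r) (inst A r)"
| papp_eq: "R \<turnstile> \<Gamma> \<rhd> EqTm Q Q' (Path A M N) \<Longrightarrow> pdim \<Gamma> r \<Longrightarrow>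
    R \<turnstile> \<Gamma> \<rhd> EqTm (PApp Q r) (PApp Q' r) (inst A r)"
| papp_0: "R \<turnstile> \<Gamma> \<rhd> HasTm Q (Path A M N) \<Longrightarrow> R \<turnstile> \<Gamma> \<rhd> EqTm (PApp Q (PEnd E0)) M (inst A (PEnd E0))"
| papp_1: "R \<turnstile> \<Gamma> \<rhd> HasTm Q (Path A M N) \<Longrightarrow> R \<turnstile> \<Gamma> \<rhd> EqTm (PApp Q (PEnd E1)) N (inst A (PEnd E1))"
| path_beta: "R \<turnstile> CPath # \<Gamma> \<rhd> HasTm P A \<Longrightarrow> wf_ctx R \<Gamma> \<Longrightarrow> pdim \<Gamma> r \<Longrightarrow>
    R \<turnstile> \<Gamma> \<rhd> EqTm (PApp (PLam P) r) (inst P r) (inst A r)"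
| path_eta: "R \<turnstile> \<Gamma> \<rhd> HasTm Q (Path A M N) \<Longrightarrow>
    R \<turnstile> \<Gamma> \<rhd> EqTm Q (PLam (PApp (wk 1 Q) (Var 0))) (Path A M N)"

  \<comment> \<open>bridge types\<close>
| bridge_form: "R \<turnstile> CBridge # \<Gamma> \<rhd> IsTy l A \<Longrightarrow> R \<turnstile> \<Gamma> \<rhd> HasTm M (inst A (BEnd E0)) \<Longrightarrow>
    R \<turnstile> \<Gamma> \<rhd> HasTm N (inst A (BEnd E1)) \<Longrightarrow> R \<turnstile> \<Gamma> \<rhd> IsTy l (Bridge A M N)"
| bridge_form_eq: "R \<turnstile> CBridge # \<Gamma> \<rhd> EqTy l A A' \<Longrightarrow> R \<turnstile> \<Gamma> \<rhd> EqTm M M' (inst A (BEnd E0)) \<Longrightarrow>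
    R \<turnstile> \<Gamma> \<rhd> EqTm N N' (inst A (BEnd E1)) \<Longrightarrow> R \<turnstile> \<Gamma> \<rhd> EqTy l (Bridge A M N) (Bridge A' M' N')"
| blam: "R \<turnstile> CBridge # \<Gamma> \<rhd> HasTm P A \<Longrightarrow> R \<turnstile> \<Gamma> \<rhd> EqTm (inst P (BEnd E0)) M (inst A (BEnd E0)) \<Longrightarrow>
    R \<turnstile> \<Gamma> \<rhd> EqTm (inst P (BEnd E1)) N (inst A (BEnd E1)) \<Longrightarrow> R \<turnstile> \<Gamma> \<rhd> HasTm (BLam P) (Bridge A M N)"
| blam_eq: "R \<turnstile> CBridge # \<Gamma> \<rhd> EqTm P P' A \<Longrightarrow> R \<turnstile> \<Gamma> \<rhd> EqTm (inst P (BEnd E0)) M (inst A (BEnd E0)) \<Longrightarrow>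
    R \<turnstile> \<Gamma> \<rhd> EqTm (inst P (BEnd E1)) N (inst A (BEnd E1)) \<Longrightarrow>
    R \<turnstile> \<Gamma> \<rhd> EqTm (BLam P) (BLam P') (Bridge A M N)"
| bapp: "wf_ctx R \<Gamma> \<Longrightarrow> bdim \<Gamma> r \<Longrightarrow> R \<turnstile> apart \<Gamma> r \<rhd> HasTm Q (Bridge A M N) \<Longrightarrow>
    R \<turnstile> \<Gamma> \<rhd> HasTm (BApp Q r) (inst A r)"
| bapp_eq: "wf_ctx R \<Gamma> \<Longrightarrow> bdim \<Gamma> r \<Longrightarrow> R \<turnstile> apart \<Gamma> r \<rhd> EqTm Q Q' (Bridge A M N) \<Longrightarrow>
    R \<turnstile> \<Gamma> \<rhd> EqTm (BApp Q r) (BApp Q' r) (inst A r)"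
| bapp_0: "R \<turnstile> \<Gamma> \<rhd> HasTm Q (Bridge A M N) \<Longrightarrow> R \<turnstile> \<Gamma> \<rhd> EqTm (BApp Q (BEnd E0)) M (inst A (BEnd E0))"
| bapp_1: "R \<turnstile> \<Gamma> \<rhd> HasTm Q (Bridge A M N) \<Longrightarrow> R \<turnstile> \<Gamma> \<rhd> EqTm (BApp Q (BEnd E1)) N (inst A (BEnd E1))"
| bridge_beta: "wf_ctx R \<Gamma> \<Longrightarrow> bdim \<Gamma> r \<Longrightarrow> R \<turnstile> CBridge # apart \<Gamma> r \<rhd> HasTm P A \<Longrightarrow>
    R \<turnstile> \<Gamma> \<rhd> EqTm (BApp (BLam P) r) (inst P r) (inst A r)"
| bridge_eta: "R \<turnstile> \<Gamma> \<rhd> HasTm Q (Bridge A M N) \<Longrightarrow>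
    R \<turnstile> \<Gamma> \<rhd> EqTm Q (BLam (BApp (wk 1 Q) (Var 0))) (Bridge A M N)"

  \<comment> \<open>Kan operations\<close>
| coe: "R \<turnstile> CPath # \<Gamma> \<rhd> IsTy Large A \<Longrightarrow> pdim \<Gamma> r \<Longrightarrow> pdim \<Gamma> s \<Longrightarrow> R \<turnstile> \<Gamma> \<rhd> HasTm M (inst A r) \<Longrightarrow>
    R \<turnstile> \<Gamma> \<rhd> HasTm (Coe A r s M) (inst A s)"
| coe_eq: "R \<turnstile> CPath # \<Gamma> \<rhd> EqTy Large A A' \<Longrightarrow> pdim \<Gamma> r \<Longrightarrow> pdim \<Gamma> s \<Longrightarrow>
    R \<turnstile> \<Gamma> \<rhd> EqTm M M' (inst A r) \<Longrightarrow> R \<turnstile> \<Gamma> \<rhd> EqTm (Coe A r s M) (Coe A' r s M') (inst A s)"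
| coe_refl: "R \<turnstile> CPath # \<Gamma> \<rhd> IsTy Large A \<Longrightarrow> pdim \<Gamma> r \<Longrightarrow> pdim \<Gamma> s \<Longrightarrow> dimeq \<Gamma> r s \<Longrightarrow>
    R \<turnstile> \<Gamma> \<rhd> HasTm M (inst A r) \<Longrightarrow> R \<turnstile> \<Gamma> \<rhd> EqTm (Coe A r s M) M (inst A s)"
| hcom: "pdim \<Gamma> r \<Longrightarrow> pdim \<Gamma> s \<Longrightarrow> \<forall>(u, v, N) \<in> set ts. constraint \<Gamma> u v \<Longrightarrow>
    \<forall>\<Delta> K. (\<Delta>, K) \<in> hcom_premises \<Gamma> A r M ts \<longrightarrow> R \<turnstile> \<Delta> \<rhd> K \<Longrightarrow> R \<turnstile> \<Gamma> \<rhd> HasTm (Hcom A r s M ts) A"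
| hcom_eq: "pdim \<Gamma> r \<Longrightarrow> pdim \<Gamma> s \<Longrightarrow> \<forall>(u, v, N) \<in> set ts. constraint \<Gamma> u v \<Longrightarrow>
    \<forall>\<Delta> K. (\<Delta>, K) \<in> hcom_premises \<Gamma> A r M ts \<longrightarrow> R \<turnstile> \<Delta> \<rhd> K \<Longrightarrow>
    \<forall>\<Delta> K. (\<Delta>, K) \<in> hcom_premises \<Gamma> A' r M' ts' \<longrightarrow> R \<turnstile> \<Delta> \<rhd> K \<Longrightarrow>
    R \<turnstile> \<Gamma> \<rhd> EqTy Large A A' \<Longrightarrow> R \<turnstile> \<Gamma> \<rhd> EqTm M M' A \<Longrightarrow> length ts = length ts' \<Longrightarrow>
    \<forall>u v N u' v' N'. ((u, v, N), (u', v', N')) \<in> set (zip ts ts') \<longrightarrow>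
      u = u' \<and> v = v' \<and> (R \<turnstile> CEq (wk 1 u) (wk 1 v) # CPath # \<Gamma> \<rhd> EqTm (wk 1 N) (wk 1 N') (wk 2 A)) \<Longrightarrow>
    R \<turnstile> \<Gamma> \<rhd> EqTm (Hcom A r s M ts) (Hcom A' r s M' ts') A"
| hcom_refl: "pdim \<Gamma> r \<Longrightarrow> pdim \<Gamma> s \<Longrightarrow> \<forall>(u, v, N) \<in> set ts. constraint \<Gamma> u v \<Longrightarrow>
    \<forall>\<Delta> K. (\<Delta>, K) \<in> hcom_premises \<Gamma> A r M ts \<longrightarrow> R \<turnstile> \<Delta> \<rhd> K \<Longrightarrow> dimeq \<Gamma> r s \<Longrightarrow>
    R \<turnstile> \<Gamma> \<rhd> EqTm (Hcom A r s M ts) M A"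
| hcom_tube: "pdim \<Gamma> r \<Longrightarrow> pdim \<Gamma> s \<Longrightarrow> \<forall>(u, v, N) \<in> set ts. constraint \<Gamma> u v \<Longrightarrow>
    \<forall>\<Delta> K. (\<Delta>, K) \<in> hcom_premises \<Gamma> A r M ts \<longrightarrow> R \<turnstile> \<Delta> \<rhd> K \<Longrightarrow> (u, v, N) \<in> set ts \<Longrightarrow> dimeq \<Gamma> u v \<Longrightarrow>
    R \<turnstile> \<Gamma> \<rhd> EqTm (Hcom A r s M ts) (inst N s) A"

  \<comment> \<open>extent\<close>
| extent: "wf_ctx R \<Gamma> \<Longrightarrow> bdim \<Gamma> r \<Longrightarrow> R \<turnstile> \<Gamma> \<rhd> HasTm M (inst A r) \<Longrightarrow>
    \<forall>\<Delta> K. (\<Delta>, K) \<in> extent_premises (apart \<Gamma> r) A B N P Q \<longrightarrow> R \<turnstile> \<Delta> \<rhd> K \<Longrightarrow>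
    R \<turnstile> \<Gamma> \<rhd> HasTm (Extent r M N P Q) (inst2 B r M)"
| extent_eq: "wf_ctx R \<Gamma> \<Longrightarrow> bdim \<Gamma> r \<Longrightarrow> R \<turnstile> \<Gamma> \<rhd> EqTm M M' (inst A r) \<Longrightarrow>
    \<forall>\<Delta> K. (\<Delta>, K) \<in> extent_premises (apart \<Gamma> r) A B N P Q \<longrightarrow> R \<turnstile> \<Delta> \<rhd> K \<Longrightarrow>
    R \<turnstile> CTm (inst A (BEnd E0)) # apart \<Gamma> r \<rhd> EqTm N N' (inst_under B (BEnd E0)) \<Longrightarrow>
    R \<turnstile> CTm (inst A (BEnd E1)) # apart \<Gamma> r \<rhd> EqTm P P' (inst_under B (BEnd E1)) \<Longrightarrow>
    R \<turnstile> CTm (edge A) # CTm (wk 1 (inst A (BEnd E1))) # CTm (inst A (BEnd E0)) # apart \<Gamma> r \<rhd>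
      EqTm Q Q' (Bridge (along B)
        (tsubst (Var 2 .: (\<lambda>n. Var (n + 3))) N) (tsubst (Var 1 .: (\<lambda>n. Var (n + 3))) P)) \<Longrightarrow>
    R \<turnstile> \<Gamma> \<rhd> EqTm (Extent r M N P Q) (Extent r M' N' P' Q') (inst2 B r M)"
| extent_0: "wf_ctx R \<Gamma> \<Longrightarrow> R \<turnstile> \<Gamma> \<rhd> HasTm M (inst A (BEnd E0)) \<Longrightarrow>
    \<forall>\<Delta> K. (\<Delta>, K) \<in> extent_premises \<Gamma> A B N P Q \<longrightarrow> R \<turnstile> \<Delta> \<rhd> K \<Longrightarrow>
    R \<turnstile> \<Gamma> \<rhd> EqTm (Extent (BEnd E0) M N P Q) (inst N M) (inst2 B (BEnd E0) M)"
| extent_1: "wf_ctx R \<Gamma> \<Longrightarrow> R \<turnstile> \<Gamma> \<rhd> HasTm M (inst A (BEnd E1)) \<Longrightarrow>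
    \<forall>\<Delta> K. (\<Delta>, K) \<in> extent_premises \<Gamma> A B N P Q \<longrightarrow> R \<turnstile> \<Delta> \<rhd> K \<Longrightarrow>
    R \<turnstile> \<Gamma> \<rhd> EqTm (Extent (BEnd E1) M N P Q) (inst P M) (inst2 B (BEnd E1) M)"
| extent_beta: "wf_ctx R \<Gamma> \<Longrightarrow> bdim \<Gamma> r \<Longrightarrow> R \<turnstile> CBridge # apart \<Gamma> r \<rhd> HasTm M A \<Longrightarrow>
    \<forall>\<Delta> K. (\<Delta>, K) \<in> extent_premises (apart \<Gamma> r) A B N P Q \<longrightarrow> R \<turnstile> \<Delta> \<rhd> K \<Longrightarrow>
    R \<turnstile> \<Gamma> \<rhd> EqTm (Extent r (inst M r) N P Q)
      (BApp (tsubst (BLam M .: inst M (BEnd E1) .: inst M (BEnd E0) .: Var) Q) r)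
      (inst2 B r (inst M r))"
| extent_eta: "wf_ctx R \<Gamma> \<Longrightarrow> bdim \<Gamma> r \<Longrightarrow> R \<turnstile> \<Gamma> \<rhd> HasTm M (inst A r) \<Longrightarrow>
    R \<turnstile> CBridge # apart \<Gamma> r \<rhd> IsTy Large A \<Longrightarrow> R \<turnstile> CTm A # CBridge # apart \<Gamma> r \<rhd> IsTy Large B \<Longrightarrow>
    R \<turnstile> CTm A # CBridge # apart \<Gamma> r \<rhd> HasTm N B \<Longrightarrow>
    R \<turnstile> \<Gamma> \<rhd> EqTm
      (Extent r M (inst_under N (BEnd E0)) (inst_under N (BEnd E1)) (BLam (along N)))
      (inst2 N r M) (inst2 B r M)"

section \<open>Equivalences\<close>

text \<open>
  As in homotopy type theory, $A \simeq B$ is the type of functions $f : A \to B$ equipped with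
  a right inverse and a left inverse up to (pointwise) paths.
\<close>

definition Arrow :: "'c tm \<Rightarrow> 'c tm \<Rightarrow> 'c tm" where
  "Arrow A B = Pi A (wk 1 B)"

definition Prod :: "'c tm \<Rightarrow> 'c tm \<Rightarrow> 'c tm" where
  "Prod A B = Sig A (wk 1 B)"

definition PathIn :: "'c tm \<Rightarrow> 'c tm \<Rightarrow> 'c tm \<Rightarrow> 'c tm" where
  "PathIn A M N = Path (wk 1 A) M N"

definition IsEquiv :: "'c tm \<Rightarrow> 'c tm \<Rightarrow> 'c tm \<Rightarrow> 'c tm" where
  "IsEquiv A B f = Prod
     (Sig (Arrow B A)
       (Pi (wk 1 B) (PathIn (wk 2 B) (App (wk 2 f) (App (Var 1) (Var 0))) (Var 0))))
     (Sig (Arrow B A)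
       (Pi (wk 1 A) (PathIn (wk 2 A) (App (Var 1) (App (wk 2 f) (Var 0))) (Var 0))))"

definition Equiv :: "'c tm \<Rightarrow> 'c tm \<Rightarrow> 'c tm" where
  "Equiv A B = Sig (Arrow A B) (IsEquiv (wk 1 A) (wk 1 B) (Var 0))"

end

theory Submission
  imports Defs
begin

text \<open>
  The two types are isomorphic up to judgmental equality, by
  $q \mapsto \lambda a\,a'\,c.\,\lambda^x.\,(q\,x)(c\,x)$ and
  $h \mapsto \lambda^x.\,\lambda m.\,\mathsf{extent}_x(m; a.\,F\,a; a'.\,F'\,a'; a\,a'\,c.\,h\,a\,a'\,c)$.
  One composite is the identity by the $\beta$-rule of extent, applied to $m = c\,x$, the other one by
  the $\eta$-rule, applied to $(q\,x)\,d$; constant paths then witness the equivalence, and no Kan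
  operation is needed.

  Since the additional rules are arbitrary, a derivable judgment does not entail that its context and
  its types are well formed.  Lemmas therefore assume these presuppositions explicitly.
\<close>

section \<open>Substitution calculus\<close>

text \<open>The obstacle is apartness. What is applied to a bridge variable x, and the branches of
  an extent over x, must be typed in the context where x and all term variables declared after it
  are \<open>Hidden\<close>. The data therefore have to be carried into such contexts and their
  consequences back out of them, which is why most statements allow an arbitrary context and are
  transported along substitutions. The \<beta>-rule of extent applies at c x because c is apart from
  x: c x is the instance at x of the term c y with y fresh. The \<eta>-rule starts from a term N
  over x and d : A and prescribes three branches: N at each end of x, and the bridge formed by N at
  c x. For N = (q x) d these are judgmentally F a, F' a' and the pointwise action of q on c, which
  are the branches that the inverse map uses when its argument h comes from q.\<close>

lemma scons_0 [simp]: "(t .: \<sigma>) 0 = t"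
  and scons_Suc [simp]: "(t .: \<sigma>) (Suc n) = \<sigma> n"
  by (simp_all add: scons_def)

lemma scons_comp [simp]: "(\<lambda>n. tsubst \<tau> ((t .: \<sigma>) n)) = tsubst \<tau> t .: (\<lambda>n. tsubst \<tau> (\<sigma> n))"
  by (auto simp: fun_eq_iff scons_def split: nat.split)

lemma scons_eta [simp]: "\<sigma> 0 .: (\<lambda>n. \<sigma> (Suc n)) = \<sigma>"
  by (auto simp: fun_eq_iff scons_def split: nat.split)

lemma scons_Var [simp]: "Var 0 .: (\<lambda>n. Var (Suc n)) = Var"
  by (auto simp: fun_eq_iff scons_def split: nat.split)

lemma upr_0 [simp]: "upr \<rho> 0 = 0"
  and upr_Suc [simp]: "upr \<rho> (Suc n) = Suc (\<rho> n)"
  by (simp_all add: upr_def)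

lemma up_0 [simp]: "up \<sigma> 0 = Var 0"
  and up_Suc [simp]: "up \<sigma> (Suc n) = wk 1 (\<sigma> n)"
  by (simp_all add: up_def)

section \<open>Renamings as substitutions, and the composition laws\<close>

lemma up_Var_comp: "(up ^^ k) (\<lambda>n. Var (\<rho> n)) = (\<lambda>n. Var ((upr ^^ k) \<rho> n))"
proof (induction k)
  case (Suc k)
  then show ?case by (auto simp: up_def upr_def scons_def fun_eq_iff split: nat.split)
qed simp

text \<open>Allows renamings to be eliminated: once every weakening is a substitution, types that
  differ by bookkeeping are compared through their substitutions alone.\<close>

lemma ren_eq_tsubst: "ren \<rho> t = tsubst (\<lambda>n. Var (\<rho> n)) t"
proof (induction t arbitrary: \<rho>)
  case (Op f ts)
  then show ?case by (fastforce simp: up_Var_comp)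
qed simp

lemma up_funpow_Var: "(up ^^ k) Var = Var"
  by (induction k) (auto simp: up_def scons_def fun_eq_iff split: nat.split)

lemma tsubst_Var [simp]: "tsubst Var t = t"
proof (induction t)
  case (Op f ts)
  then show ?case by (auto simp: up_funpow_Var intro!: map_idI)
qed simp

lemma upr_funpow_comp: "(up ^^ k) \<sigma> ((upr ^^ k) \<rho> n) = (up ^^ k) (\<lambda>n. \<sigma> (\<rho> n)) n"
proof (induction k arbitrary: n)
  case (Suc k)
  then show ?case by (auto simp: up_def upr_def scons_def split: nat.split)
qed simp

lemma tsubst_ren: "tsubst \<sigma> (ren \<rho> t) = tsubst (\<lambda>n. \<sigma> (\<rho> n)) t"
proof (induction t arbitrary: \<sigma> \<rho>)
  case (Op f ts)
  then show ?case by (fastforce simp: upr_funpow_comp)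
qed simp

lemma ren_ren: "ren \<rho>' (ren \<rho> t) = ren (\<lambda>n. \<rho>' (\<rho> n)) t"
  by (simp add: ren_eq_tsubst[of \<rho>'] ren_eq_tsubst[of "\<lambda>n. \<rho>' (\<rho> n)"] tsubst_ren)

lemma up_ren_funpow_comp: "ren ((upr ^^ k) \<rho>) ((up ^^ k) \<sigma> n) = (up ^^ k) (\<lambda>n. ren \<rho> (\<sigma> n)) n"
proof (induction k arbitrary: n)
  case (Suc k)
  then show ?case
    by (cases n) (simp_all add: ren_ren flip: Suc.IH)
qed simp

lemma ren_tsubst: "ren \<rho> (tsubst \<sigma> t) = tsubst (\<lambda>n. ren \<rho> (\<sigma> n)) t"
proof (induction t arbitrary: \<sigma> \<rho>)
  case (Op f ts)
  then show ?case by (fastforce simp: up_ren_funpow_comp)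
qed simp

text \<open>Since \<open>up\<close> weakens each component by a renaming, composing substitutions
  under binders rests on the two mixed laws \<open>tsubst_ren\<close> and
  \<open>ren_tsubst\<close>.\<close>

lemma up_funpow_comp: "tsubst ((up ^^ k) \<tau>) ((up ^^ k) \<sigma> n) = (up ^^ k) (\<lambda>n. tsubst \<tau> (\<sigma> n)) n"
proof (induction k arbitrary: n)
  case (Suc k)
  then show ?case
    by (cases n) (simp_all add: tsubst_ren ren_tsubst flip: Suc.IH)
qed simp

lemma tsubst_tsubst [simp]: "tsubst \<tau> (tsubst \<sigma> t) = tsubst (\<lambda>n. tsubst \<tau> (\<sigma> n)) t"
proof (induction t arbitrary: \<sigma> \<tau>)
  case (Op f ts)
  then show ?case by (fastforce simp: up_funpow_comp)
qed simp

lemma up_eq: "up \<sigma> = Var 0 .: (\<lambda>n. tsubst (\<lambda>n. Var (Suc n)) (\<sigma> n))"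
  by (simp add: up_def ren_eq_tsubst)

lemma upr_Var: "(\<lambda>n. Var (upr \<rho> n)) = Var 0 .: (\<lambda>n. Var (Suc (\<rho> n)))"
  by (auto simp: fun_eq_iff upr_def scons_def split: nat.split)

lemma scons_Var_Suc [simp]: "Var (Suc 0) .: (\<lambda>n. Var (Suc (Suc n))) = (\<lambda>n. Var (Suc n))"
  using scons_eta[of "\<lambda>n. Var (Suc n)"] .

lemma inst_wk: "inst (wk 1 t) s = t"
  by (simp add: inst_def ren_eq_tsubst)

declare ren.simps(2) [simp del]

text \<open>Normal form of index computations: a single \<open>tsubst\<close> along an explicit
  \<open>.:\<close> sequence. Numerals are expanded so that \<open>scons_Suc\<close> can evaluate at
  indices such as 2, and \<open>ren.simps(2)\<close> is switched off so that a renaming becomes a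
  substitution before it is pushed through an operator.\<close>

lemmas subst_simps = ren_eq_tsubst up_eq upr_Var inst_def inst_under_def inst2_def edge_def along_def
  eval_nat_numeral

section \<open>Structural properties\<close>

inductive_cases wf_ctx_ConsE: "wf_ctx R (e # \<Gamma>)"
inductive_cases wf_ctx_tmE: "wf_ctx R (CTm A # \<Gamma>)"
inductive_cases wf_ctx_eqE: "wf_ctx R (CEq u v # \<Gamma>)"
inductive_cases wf_sub_NilE: "wf_sub R \<Delta> \<sigma> []"
inductive_cases wf_sub_tmE: "wf_sub R \<Delta> \<sigma> (CTm A # \<Gamma>)"
inductive_cases wf_sub_pathE: "wf_sub R \<Delta> \<sigma> (CPath # \<Gamma>)"
inductive_cases wf_sub_bridgeE: "wf_sub R \<Delta> \<sigma> (CBridge # \<Gamma>)"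
inductive_cases wf_sub_eqE: "wf_sub R \<Delta> \<sigma> (CEq u v # \<Gamma>)"
inductive_cases wf_sub_hiddenE: "wf_sub R \<Delta> \<sigma> (Hidden # \<Gamma>)"

lemma wf_ctx_tl: "wf_ctx R (e # \<Gamma>) \<Longrightarrow> wf_ctx R \<Gamma>"
  by (erule wf_ctx_ConsE)

section \<open>Apart contexts, thinning, and lifting of substitutions\<close>

lemma length_hide [simp]: "length (hide \<Gamma> n) = length \<Gamma>"
  by (induction \<Gamma> n rule: hide.induct) auto

lemma hide_nth_after [simp]: "n < m \<Longrightarrow> hide \<Gamma> n ! m = \<Gamma> ! m"
proof (induction \<Gamma> n arbitrary: m rule: hide.induct)
  case (3 e \<Gamma> n)
  then show ?case by (cases m) auto
qed (auto simp: nth_Cons split: nat.split)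

lemma hide_nth_CPath: "m < length \<Gamma> \<Longrightarrow> hide \<Gamma> n ! m = CPath \<Longrightarrow> \<Gamma> ! m = CPath"
proof (induction \<Gamma> n arbitrary: m rule: hide.induct)
  case (3 e \<Gamma> n)
  then show ?case by (cases m) (auto split: entry.splits if_splits)
qed (auto simp: nth_Cons split: nat.splits)

lemma hide_nth_CBridge: "m < length \<Gamma> \<Longrightarrow> hide \<Gamma> n ! m = CBridge \<Longrightarrow> \<Gamma> ! m = CBridge"
proof (induction \<Gamma> n arbitrary: m rule: hide.induct)
  case (3 e \<Gamma> n)
  then show ?case by (cases m) (auto split: entry.splits if_splits)
qed (auto simp: nth_Cons split: nat.splits)

lemma hide_nth: "m < length \<Gamma> \<Longrightarrow> hide \<Gamma> n ! m = Hidden \<or> hide \<Gamma> n ! m = \<Gamma> ! m"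
proof (induction \<Gamma> n arbitrary: m rule: hide.induct)
  case (3 e \<Gamma> n)
  then show ?case by (cases m) (auto split: entry.splits if_splits)
qed (auto simp: nth_Cons split: nat.splits)

lemma hide_nth_dim: "m < length \<Gamma> \<Longrightarrow> m \<noteq> n \<Longrightarrow> \<Gamma> ! m = CPath \<or> \<Gamma> ! m = CBridge \<Longrightarrow>
   hide \<Gamma> n ! m = \<Gamma> ! m"
proof (induction \<Gamma> n arbitrary: m rule: hide.induct)
  case (3 e \<Gamma> n)
  then show ?case by (cases m) (auto split: entry.splits if_splits)
qed (auto simp: nth_Cons split: nat.splits)

lemma pdim_hide: "pdim \<Gamma> r \<Longrightarrow> r \<noteq> Var n \<Longrightarrow> pdim (hide \<Gamma> n) r"
  by (auto simp: pdim_def hide_nth_dim)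

lemma bdim_hide: "bdim \<Gamma> r \<Longrightarrow> r \<noteq> Var n \<Longrightarrow> bdim (hide \<Gamma> n) r"
  by (auto simp: bdim_def hide_nth_dim)

lemma constraint_hide: "constraint \<Gamma> u v \<Longrightarrow> u \<noteq> Var n \<Longrightarrow> v \<noteq> Var n \<Longrightarrow> constraint (hide \<Gamma> n) u v"
  unfolding constraint_def using pdim_hide bdim_hide by blast

text \<open>No typing has to be strengthened: every term variable declared after the hidden index is
  withdrawn with it, and of the later constraints only those that avoid this index stay.\<close>

lemma wf_ctx_hide: "wf_ctx R \<Gamma> \<Longrightarrow> wf_ctx R (hide \<Gamma> n)"
proof (induction \<Gamma> n rule: hide.induct)
  case (2 e \<Gamma>)
  then show ?case by (auto intro: ctx_hidden wf_ctx_tl)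
next
  case (3 e \<Gamma> n)
  then have "wf_ctx R (hide \<Gamma> n)" by (auto intro: wf_ctx_tl)
  with 3(2) show ?case
    by (cases e) (auto intro: ctx_hidden ctx_path ctx_bridge ctx_eq constraint_hide elim: wf_ctx_eqE)
qed (auto intro: ctx_nil)

lemma wf_ctx_apart: "wf_ctx R \<Gamma> \<Longrightarrow> wf_ctx R (apart \<Gamma> r)"
  by (cases r) (auto intro: wf_ctx_hide)

text \<open>The source of all weakenings. Up to \<open>Hidden\<close> entries,
  \<open>\<Theta>\<close> is read off from \<open>\<Delta>\<close> starting at index
  \<open>k\<close>; positive \<open>k\<close> gives weakening, and \<open>k = 0\<close> gives the
  passage back from an apart context.\<close>

lemma wf_sub_thin:
  assumes "wf_ctx R \<Delta>" "wf_ctx R \<Theta>"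
    and "\<And>n. n < length \<Theta> \<Longrightarrow> \<Theta> ! n = Hidden \<or> n + k < length \<Delta> \<and> \<Delta> ! (n + k) = \<Theta> ! n"
  shows "wf_sub R \<Delta> (\<lambda>n. Var (n + k)) \<Theta>"
  using assms
proof (induction \<Theta> arbitrary: \<Delta> k)
  case Nil
  then show ?case by (auto intro: sub_nil)
next
  case (Cons e \<Theta>)
  have tl: "wf_ctx R \<Theta>" using Cons.prems(2) by (rule wf_ctx_tl)
  have nth: "\<Theta> ! n = Hidden \<or> n + Suc k < length \<Delta> \<and> \<Delta> ! (n + Suc k) = \<Theta> ! n"
    if "n < length \<Theta>" for n
    using Cons.prems(3)[of "Suc n"] that by auto
  have IH: "wf_sub R \<Delta> (\<lambda>n. Var (Suc n + k)) \<Theta>"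
    using Cons.IH[OF Cons.prems(1) tl nth] by simp
  have hd: "e = Hidden \<or> k < length \<Delta> \<and> \<Delta> ! k = e"
    using Cons.prems(3)[of 0] by simp
  show ?case
  proof (cases e)
    case (CTm A)
    then have "R \<turnstile> \<Theta> \<rhd> IsTy Large A" using Cons.prems(2) by (auto elim: wf_ctx_tmE)
    moreover have "R \<turnstile> \<Delta> \<rhd> HasTm (Var (0 + k)) (tsubst (\<lambda>n. Var (Suc n + k)) A)"
      using variable[OF Cons.prems(1), of k A] hd CTm by (simp add: ren_eq_tsubst)
    ultimately show ?thesis using CTm IH by (auto intro: sub_tm)
  next
    case CPath
    then show ?thesis using IH hd by (auto intro!: sub_path simp: pdim_def)
  next
    case CBridge
    \<comment> \<open>Hiding index \<open>k\<close> changes nothing beyond it, and the remaining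
      variables are sent to indices from \<open>k + 1\<close> on. So the induction hypothesis
      applies to the apart context as well.\<close>
    have "wf_sub R (hide \<Delta> k) (\<lambda>n. Var (n + Suc k)) \<Theta>"
      using nth by (intro Cons.IH wf_ctx_hide Cons.prems(1) tl) auto
    then show ?thesis using CBridge hd Cons.prems(1) by (auto intro!: sub_bridge simp: bdim_def)
  next
    case (CEq u v)
    then have "constraint \<Theta> u v" using Cons.prems(2) by (auto elim: wf_ctx_eqE)
    moreover have "dimeq \<Delta> (wk (Suc k) u) (wk (Suc k) v)"
      using hd CEq dimeq_hyp[of k \<Delta> u v] by simp
    ultimately show ?thesis using CEq IH by (auto intro!: sub_eq simp: ren_eq_tsubst)
  next
    case Hidden
    then show ?thesis using IH by (auto intro: sub_hidden)
  qed
qed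

lemma wf_sub_id: "wf_ctx R \<Gamma> \<Longrightarrow> wf_sub R \<Gamma> Var \<Gamma>"
  using wf_sub_thin[of R \<Gamma> \<Gamma> 0] by simp

lemma wf_sub_shift: "wf_ctx R (e # \<Gamma>) \<Longrightarrow> wf_sub R (e # \<Gamma>) (\<lambda>n. Var (Suc n)) \<Gamma>"
  using wf_sub_thin[of R "e # \<Gamma>" \<Gamma> 1] wf_ctx_tl by fastforce

text \<open>Forgetting apartness: along this substitution, what is derivable apart from
  \<open>r\<close> becomes derivable in the full context.\<close>

lemma wf_sub_apart: "wf_ctx R \<Gamma> \<Longrightarrow> wf_sub R \<Gamma> Var (apart \<Gamma> r)"
  using wf_sub_thin[of R \<Gamma> "apart \<Gamma> r" 0] wf_ctx_apart[of R \<Gamma> r]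
  by (cases r) (auto simp: hide_nth dest: hide_nth, metis hide_nth)

lemma weaken: "wf_ctx R (e # \<Gamma>) \<Longrightarrow> R \<turnstile> \<Gamma> \<rhd> J \<Longrightarrow> R \<turnstile> e # \<Gamma> \<rhd> jsubst (\<lambda>n. Var (Suc n)) J"
  by (rule substitution[OF wf_sub_shift])

lemma wf_sub_codomain: "wf_sub R \<Delta> \<sigma> \<Gamma> \<Longrightarrow> wf_ctx R \<Delta>"
proof (induction \<Gamma> arbitrary: \<Delta> \<sigma>)
  case Nil
  then show ?case by (auto elim: wf_sub_NilE)
next
  case (Cons e \<Gamma>)
  then show ?case
    by (cases e) (auto elim: wf_sub_tmE wf_sub_pathE wf_sub_bridgeE wf_sub_eqE wf_sub_hiddenE)
qed

lemma pdim_shift: "pdim \<Gamma> r \<Longrightarrow> pdim (e # \<Gamma>) (tsubst (\<lambda>n. Var (Suc n)) r)"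
  by (auto simp: pdim_def)

lemma bdim_shift: "bdim \<Gamma> r \<Longrightarrow> bdim (e # \<Gamma>) (tsubst (\<lambda>n. Var (Suc n)) r)"
  by (auto simp: bdim_def)

lemma dimeq_shift: "dimeq \<Gamma> r s \<Longrightarrow>
  dimeq (e # \<Gamma>) (tsubst (\<lambda>n. Var (Suc n)) r) (tsubst (\<lambda>n. Var (Suc n)) s)"
proof (induction rule: dimeq.induct)
  case (dimeq_refl r)
  then show ?case by (intro dimeq.dimeq_refl) (auto dest: pdim_shift bdim_shift)
next
  case (dimeq_hyp n r s)
  then show ?case using dimeq.dimeq_hyp[of "Suc n" "e # \<Gamma>" r s] by (simp add: ren_eq_tsubst)
qed (auto intro: dimeq_sym dimeq_trans)

text \<open>The induction generalizes over \<open>\<Delta>\<close> and \<open>e\<close>: at a bridge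
  variable of \<open>\<Gamma>\<close>, the rest of \<open>\<sigma>\<close> lives in the context
  apart from \<open>\<sigma> 0\<close>, and there the added entry \<open>e\<close> may turn into
  \<open>Hidden\<close>.\<close>

lemma wf_sub_weaken:
  "wf_sub R \<Delta> \<sigma> \<Gamma> \<Longrightarrow> wf_ctx R (e # \<Delta>) \<Longrightarrow>
    wf_sub R (e # \<Delta>) (\<lambda>n. tsubst (\<lambda>n. Var (Suc n)) (\<sigma> n)) \<Gamma>"
proof (induction \<Gamma> arbitrary: \<Delta> \<sigma> e)
  case Nil
  then show ?case by (auto intro: sub_nil)
next
  case (Cons d \<Gamma>)
  show ?case
  proof (cases d)
    case (CTm A)
    with Cons.prems have "wf_sub R \<Delta> (\<lambda>n. \<sigma> (Suc n)) \<Gamma>" "R \<turnstile> \<Gamma> \<rhd> IsTy Large A"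
      "R \<turnstile> \<Delta> \<rhd> HasTm (\<sigma> 0) (tsubst (\<lambda>n. \<sigma> (Suc n)) A)"
      by (auto elim: wf_sub_tmE)
    with weaken[OF Cons.prems(2) this(3)] Cons.IH[OF _ Cons.prems(2)] show ?thesis
      unfolding CTm by (intro sub_tm) simp_all
  next
    case CPath
    with Cons.prems have "wf_sub R \<Delta> (\<lambda>n. \<sigma> (Suc n)) \<Gamma>" "pdim \<Delta> (\<sigma> 0)"
      by (auto elim: wf_sub_pathE)
    with Cons.IH[OF _ Cons.prems(2)] show ?thesis
      unfolding CPath by (intro sub_path pdim_shift)
  next
    case CBridge
    with Cons.prems have sub: "bdim \<Delta> (\<sigma> 0)" "wf_sub R (apart \<Delta> (\<sigma> 0)) (\<lambda>n. \<sigma> (Suc n)) \<Gamma>"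
      by (auto elim: wf_sub_bridgeE)
    obtain e' where e': "apart (e # \<Delta>) (tsubst (\<lambda>n. Var (Suc n)) (\<sigma> 0)) = e' # apart \<Delta> (\<sigma> 0)"
      using sub(1) by (auto simp: bdim_def)
    then have "wf_ctx R (e' # apart \<Delta> (\<sigma> 0))"
      using wf_ctx_apart[OF Cons.prems(2), of "tsubst (\<lambda>n. Var (Suc n)) (\<sigma> 0)"] by simp
    from Cons.IH[OF sub(2) this] show ?thesis
      unfolding CBridge by (intro sub_bridge Cons.prems(2) bdim_shift sub(1)) (simp add: e')
  next
    case (CEq u v)
    with Cons.prems have "wf_sub R \<Delta> (\<lambda>n. \<sigma> (Suc n)) \<Gamma>" "constraint \<Gamma> u v"
      "dimeq \<Delta> (tsubst (\<lambda>n. \<sigma> (Suc n)) u) (tsubst (\<lambda>n. \<sigma> (Suc n)) v)"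
      by (auto elim: wf_sub_eqE)
    with dimeq_shift[OF this(3), of e] Cons.IH[OF _ Cons.prems(2)] show ?thesis
      unfolding CEq by (intro sub_eq) simp_all
  next
    case Hidden
    with Cons.prems have "wf_sub R \<Delta> (\<lambda>n. \<sigma> (Suc n)) \<Gamma>"
      by (auto elim: wf_sub_hiddenE)
    from Cons.IH[OF this Cons.prems(2)] show ?thesis
      unfolding Hidden by (rule sub_hidden)
  qed
qed

lemma wf_sub_up_bridge:
  assumes "wf_sub R \<Delta> \<sigma> \<Gamma>"
  shows "wf_sub R (CBridge # \<Delta>) (up \<sigma>) (CBridge # \<Gamma>)"
proof (rule sub_bridge)
  have "wf_ctx R \<Delta>" using assms by (rule wf_sub_codomain)
  then show "wf_ctx R (CBridge # \<Delta>)" by (rule ctx_bridge)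
  show "bdim (CBridge # \<Delta>) (up \<sigma> 0)" by (simp add: up_eq bdim_def)
  \<comment> \<open>Apart from the new variable, the context is \<open>Hidden # \<Delta>\<close>, so
    the tail is weakened by a hidden entry.\<close>
  show "wf_sub R (apart (CBridge # \<Delta>) (up \<sigma> 0)) (\<lambda>n. up \<sigma> (Suc n)) \<Gamma>"
    using wf_sub_weaken[OF assms ctx_hidden[OF \<open>wf_ctx R \<Delta>\<close>]] by (simp add: up_eq)
qed

lemma wf_sub_up_tm:
  assumes "wf_sub R \<Delta> \<sigma> \<Gamma>" "R \<turnstile> \<Gamma> \<rhd> IsTy Large A"
  shows "wf_sub R (CTm (tsubst \<sigma> A) # \<Delta>) (up \<sigma>) (CTm A # \<Gamma>)"
proof (rule sub_tm)
  have ctx: "wf_ctx R (CTm (tsubst \<sigma> A) # \<Delta>)"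
    using substitution[OF assms] wf_sub_codomain[OF assms(1)] by (simp add: ctx_tm)
  show "wf_sub R (CTm (tsubst \<sigma> A) # \<Delta>) (\<lambda>n. up \<sigma> (Suc n)) \<Gamma>"
    using wf_sub_weaken[OF assms(1) ctx] by (simp add: up_eq)
  show "R \<turnstile> CTm (tsubst \<sigma> A) # \<Delta> \<rhd> HasTm (up \<sigma> 0) (tsubst (\<lambda>n. up \<sigma> (Suc n)) A)"
    using variable[OF ctx, of 0] by (simp add: up_eq ren_eq_tsubst)
qed (rule assms(2))

lemma wf_sub_var:
  "wf_sub R \<Delta> \<sigma> \<Gamma> \<Longrightarrow> n < length \<Gamma> \<Longrightarrow> \<Gamma> ! n = CTm A \<Longrightarrow>
    R \<turnstile> \<Delta> \<rhd> HasTm (\<sigma> n) (tsubst \<sigma> (wk (Suc n) A))"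
proof (induction \<Gamma> arbitrary: \<Delta> \<sigma> n)
  case (Cons e \<Gamma>)
  have *: "R \<turnstile> \<Delta>' \<rhd> HasTm (\<sigma> n) (tsubst \<sigma> (wk (Suc n) A))"
    if "wf_sub R \<Delta>' (\<lambda>n. \<sigma> (Suc n)) \<Gamma>" "n = Suc m" for m \<Delta>'
    using Cons.IH[OF that(1), of m] Cons.prems(2-3) that(2) by (simp add: ren_eq_tsubst)
  show ?case
  proof (cases n)
    case 0
    then show ?thesis using Cons.prems by (auto elim!: wf_sub_tmE simp: ren_eq_tsubst)
  next
    case (Suc m)
    show ?thesis
    proof (cases e)
      case CBridge
      then have "wf_ctx R \<Delta>" "wf_sub R (apart \<Delta> (\<sigma> 0)) (\<lambda>n. \<sigma> (Suc n)) \<Gamma>"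
        using Cons.prems(1) by (auto elim: wf_sub_bridgeE)
      \<comment> \<open>Past a bridge variable the component is typed only apart from the image of
        that variable; \<open>wf_sub_apart\<close> brings it back to
        \<open>\<Delta>\<close>.\<close>
      then show ?thesis
        using substitution[OF wf_sub_apart *[OF _ Suc]] by simp
    qed (use Cons.prems(1) *[OF _ Suc] in
        \<open>auto elim: wf_sub_tmE wf_sub_pathE wf_sub_eqE wf_sub_hiddenE\<close>)
  qed
qed simp

lemma dim_apart: "pdim (apart \<Gamma> r) s \<or> bdim (apart \<Gamma> r) s \<Longrightarrow> pdim \<Gamma> s \<or> bdim \<Gamma> s"
  by (cases r) (auto simp: pdim_def bdim_def dest: hide_nth_CPath hide_nth_CBridge)

lemma wf_sub_dim:
  "wf_sub R \<Delta> \<sigma> \<Gamma> \<Longrightarrow> n < length \<Gamma> \<Longrightarrow> \<Gamma> ! n = CPath \<or> \<Gamma> ! n = CBridge \<Longrightarrow>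
    pdim \<Delta> (\<sigma> n) \<or> bdim \<Delta> (\<sigma> n)"
proof (induction \<Gamma> arbitrary: \<Delta> \<sigma> n)
  case (Cons e \<Gamma>)
  show ?case
  proof (cases n)
    case 0
    then show ?thesis using Cons.prems by (auto elim: wf_sub_pathE wf_sub_bridgeE)
  next
    case (Suc m)
    obtain \<Delta>' where "wf_sub R \<Delta>' (\<lambda>n. \<sigma> (Suc n)) \<Gamma>" "\<Delta>' = \<Delta> \<or> (\<exists>r. \<Delta>' = apart \<Delta> r)"
      using Cons.prems(1)
      by (cases e) (auto elim: wf_sub_tmE wf_sub_pathE wf_sub_bridgeE wf_sub_eqE wf_sub_hiddenE)
    then show ?thesis using Cons.IH[of \<Delta>' "\<lambda>n. \<sigma> (Suc n)" m] Cons.prems(2-3) Suc dim_apart by fastforce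
  qed
qed simp

text \<open>The instance of \<open>ty_subst_eq\<close> where the two substitutions share their tail,
  on which they agree by reflexivity. It lets the endpoint of a bridge be replaced inside a
  dependent type.\<close>

lemma scons_subst_eq:
  assumes sub: "wf_sub R \<Delta> \<sigma> \<Gamma>" and A: "R \<turnstile> \<Gamma> \<rhd> IsTy Large A"
    and s: "R \<turnstile> \<Delta> \<rhd> HasTm s (tsubst \<sigma> A)" and t: "R \<turnstile> \<Delta> \<rhd> HasTm t (tsubst \<sigma> A)"
    and st: "R \<turnstile> \<Delta> \<rhd> EqTm s t (tsubst \<sigma> A)"
    and B: "R \<turnstile> CTm A # \<Gamma> \<rhd> IsTy l B"
  shows "R \<turnstile> \<Delta> \<rhd> EqTy l (tsubst (s .: \<sigma>) B) (tsubst (t .: \<sigma>) B)"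
proof (rule ty_subst_eq[OF _ _ _ _ B])
  show "wf_sub R \<Delta> (s .: \<sigma>) (CTm A # \<Gamma>)" "wf_sub R \<Delta> (t .: \<sigma>) (CTm A # \<Gamma>)"
    using assms by (auto intro: sub_tm)
  show "\<forall>n A'. n < length (CTm A # \<Gamma>) \<longrightarrow> (CTm A # \<Gamma>) ! n = CTm A' \<longrightarrow>
      R \<turnstile> \<Delta> \<rhd> EqTm ((s .: \<sigma>) n) ((t .: \<sigma>) n) (tsubst (s .: \<sigma>) (wk (Suc n) A'))"
  proof (intro allI impI)
    fix n A' assume "n < length (CTm A # \<Gamma>)" "(CTm A # \<Gamma>) ! n = CTm A'"
    then show "R \<turnstile> \<Delta> \<rhd> EqTm ((s .: \<sigma>) n) ((t .: \<sigma>) n) (tsubst (s .: \<sigma>) (wk (Suc n) A'))"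
      using st tm_refl[OF wf_sub_var[OF sub, of "n - 1" A']] by (cases n) (auto simp: ren_eq_tsubst)
  qed
  show "\<forall>n. n < length (CTm A # \<Gamma>) \<longrightarrow> (CTm A # \<Gamma>) ! n = CPath \<or> (CTm A # \<Gamma>) ! n = CBridge \<longrightarrow>
      dimeq \<Delta> ((s .: \<sigma>) n) ((t .: \<sigma>) n)"
    using wf_sub_dim[OF sub] by (auto simp: nth_Cons intro!: dimeq_refl split: nat.splits)
qed

section \<open>Derived rules\<close>

lemma bdim_end [simp]: "bdim \<Gamma> (BEnd \<epsilon>)"
  by (simp add: bdim_def)

lemma bdim_0 [simp]: "bdim (CBridge # \<Gamma>) (Var 0)"
  by (simp add: bdim_def)

lemma wf_sub_bend: "wf_ctx R \<Gamma> \<Longrightarrow> wf_sub R \<Gamma> (BEnd \<epsilon> .: Var) (CBridge # \<Gamma>)"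
  by (rule sub_bridge) (simp_all add: wf_sub_id)

lemma variable_0: "wf_ctx R (CTm A # \<Gamma>) \<Longrightarrow> R \<turnstile> CTm A # \<Gamma> \<rhd> HasTm (Var 0) (wk 1 A)"
  using variable[of R "CTm A # \<Gamma>" 0 A] by simp

lemma bapp_end: "wf_ctx R \<Gamma> \<Longrightarrow> R \<turnstile> \<Gamma> \<rhd> HasTm Q (Bridge A M N) \<Longrightarrow>
    R \<turnstile> \<Gamma> \<rhd> HasTm (BApp Q (BEnd \<epsilon>)) (inst A (BEnd \<epsilon>))"
  by (rule bapp) simp_all

text \<open>Apart from the fresh variable \<open>Var 0\<close> the context is
  \<open>Hidden # \<Gamma>\<close>, so every bridge of \<open>\<Gamma>\<close>, once weakened, may
  be applied to it.\<close>

lemma bapp_var: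
  assumes "wf_ctx R \<Gamma>" "R \<turnstile> \<Gamma> \<rhd> HasTm Q (Bridge A M N)"
  shows "R \<turnstile> CBridge # \<Gamma> \<rhd> HasTm (BApp (wk 1 Q) (Var 0)) A"
proof -
  let ?s = "tsubst (\<lambda>n. Var (Suc n))"
  have "R \<turnstile> apart (CBridge # \<Gamma>) (Var 0) \<rhd> HasTm (?s Q) (Bridge (tsubst (up (\<lambda>n. Var (Suc n))) A) (?s M) (?s N))"
    using weaken[OF ctx_hidden[OF assms(1)] assms(2)] by simp
  from bapp[OF ctx_bridge[OF assms(1)] bdim_0 this] show ?thesis by (simp add: subst_simps)
qed

lemma bapp_var_eq:
  assumes "wf_ctx R \<Gamma>" "R \<turnstile> \<Gamma> \<rhd> EqTm Q Q' (Bridge A M N)"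
  shows "R \<turnstile> CBridge # \<Gamma> \<rhd> EqTm (BApp (wk 1 Q) (Var 0)) (BApp (wk 1 Q') (Var 0)) A"
proof -
  let ?s = "tsubst (\<lambda>n. Var (Suc n))"
  have "R \<turnstile> apart (CBridge # \<Gamma>) (Var 0) \<rhd> EqTm (?s Q) (?s Q') (Bridge (tsubst (up (\<lambda>n. Var (Suc n))) A) (?s M) (?s N))"
    using weaken[OF ctx_hidden[OF assms(1)] assms(2)] by simp
  from bapp_eq[OF ctx_bridge[OF assms(1)] bdim_0 this] show ?thesis by (simp add: subst_simps)
qed

lemma bridge_beta_var:
  assumes "wf_ctx R \<Gamma>" "R \<turnstile> CBridge # \<Gamma> \<rhd> HasTm P A"
  shows "R \<turnstile> CBridge # \<Gamma> \<rhd> EqTm (BApp (wk 1 (BLam P)) (Var 0)) P A"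
proof -
  let ?s = "tsubst (up (\<lambda>n. Var (Suc n)))"
  have "R \<turnstile> CBridge # Hidden # \<Gamma> \<rhd> jsubst (up (\<lambda>n. Var (Suc n))) (HasTm P A)"
    by (intro substitution[OF wf_sub_up_bridge[OF wf_sub_shift]] ctx_hidden assms)
  then have "R \<turnstile> CBridge # apart (CBridge # \<Gamma>) (Var 0) \<rhd> HasTm (?s P) (?s A)"
    by simp
  from bridge_beta[OF ctx_bridge[OF assms(1)] bdim_0 this] show ?thesis by (simp add: subst_simps)
qed

lemma app_var:
  assumes "wf_ctx R (CTm A # \<Gamma>)" "R \<turnstile> \<Gamma> \<rhd> HasTm M (Pi A B)"
  shows "R \<turnstile> CTm A # \<Gamma> \<rhd> HasTm (App (wk 1 M) (Var 0)) B"
proof -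
  let ?s = "tsubst (\<lambda>n. Var (Suc n))"
  have "R \<turnstile> CTm A # \<Gamma> \<rhd> HasTm (?s M) (Pi (wk 1 A) (tsubst (up (\<lambda>n. Var (Suc n))) B))"
    using weaken[OF assms] by (simp add: ren_eq_tsubst)
  from app[OF this variable_0[OF assms(1)]] show ?thesis by (simp add: subst_simps)
qed

lemma app_var_eq:
  assumes "wf_ctx R (CTm A # \<Gamma>)" "R \<turnstile> \<Gamma> \<rhd> EqTm M M' (Pi A B)"
  shows "R \<turnstile> CTm A # \<Gamma> \<rhd> EqTm (App (wk 1 M) (Var 0)) (App (wk 1 M') (Var 0)) B"
proof -
  let ?s = "tsubst (\<lambda>n. Var (Suc n))"
  have "R \<turnstile> CTm A # \<Gamma> \<rhd> EqTm (?s M) (?s M') (Pi (wk 1 A) (tsubst (up (\<lambda>n. Var (Suc n))) B))"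
    using weaken[OF assms] by (simp add: ren_eq_tsubst)
  from app_eq[OF this tm_refl[OF variable_0[OF assms(1)]]] show ?thesis by (simp add: subst_simps)
qed

lemma pi_beta_var:
  assumes ctx: "wf_ctx R (CTm A # \<Gamma>)" and A: "R \<turnstile> \<Gamma> \<rhd> IsTy Large A" and M: "R \<turnstile> CTm A # \<Gamma> \<rhd> HasTm M B"
  shows "R \<turnstile> CTm A # \<Gamma> \<rhd> EqTm (App (wk 1 (Lam M)) (Var 0)) M B"
proof -
  let ?s = "tsubst (up (\<lambda>n. Var (Suc n)))"
  have "R \<turnstile> CTm (tsubst (\<lambda>n. Var (Suc n)) A) # CTm A # \<Gamma> \<rhd> jsubst (up (\<lambda>n. Var (Suc n))) (HasTm M B)"
    by (intro substitution[OF wf_sub_up_tm[OF wf_sub_shift]] assms)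
  then have M': "R \<turnstile> CTm (wk 1 A) # CTm A # \<Gamma> \<rhd> HasTm (?s M) (?s B)"
    by (simp add: ren_eq_tsubst)
  have "R \<turnstile> CTm A # \<Gamma> \<rhd> IsTy Large (wk 1 A)"
    using weaken[OF ctx A] by (simp add: ren_eq_tsubst)
  from pi_beta[OF this M' variable_0[OF ctx]] show ?thesis by (simp add: subst_simps)
qed

section \<open>Bridges of functions\<close>

text \<open>Bundled so that the hypotheses can be moved along a substitution in one step and reused
  in every extended or apart context.\<close>

definition pi_data where
  "pi_data R \<Gamma> A B F F' \<longleftrightarrow> wf_ctx R \<Gamma> \<and> R \<turnstile> CBridge # \<Gamma> \<rhd> IsTy Large A \<and>
    R \<turnstile> CTm A # CBridge # \<Gamma> \<rhd> IsTy Large B \<and>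
    R \<turnstile> \<Gamma> \<rhd> HasTm F (Pi (inst A (BEnd E0)) (inst_under B (BEnd E0))) \<and>
    R \<turnstile> \<Gamma> \<rhd> HasTm F' (Pi (inst A (BEnd E1)) (inst_under B (BEnd E1)))"

lemma pi_dataD:
  assumes "pi_data R \<Gamma> A B F F'"
  shows "wf_ctx R \<Gamma>" "R \<turnstile> CBridge # \<Gamma> \<rhd> IsTy Large A" "R \<turnstile> CTm A # CBridge # \<Gamma> \<rhd> IsTy Large B"
    "R \<turnstile> \<Gamma> \<rhd> HasTm F (Pi (inst A (BEnd E0)) (inst_under B (BEnd E0)))"
    "R \<turnstile> \<Gamma> \<rhd> HasTm F' (Pi (inst A (BEnd E1)) (inst_under B (BEnd E1)))"
    "wf_ctx R (CBridge # \<Gamma>)" "wf_ctx R (CTm A # CBridge # \<Gamma>)"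
    "R \<turnstile> \<Gamma> \<rhd> IsTy Large (inst A (BEnd \<epsilon>))" "wf_ctx R (CTm (inst A (BEnd \<epsilon>)) # \<Gamma>)"
    "R \<turnstile> CTm (inst A (BEnd \<epsilon>)) # \<Gamma> \<rhd> IsTy Large (inst_under B (BEnd \<epsilon>))"
proof -
  show *: "wf_ctx R \<Gamma>" "R \<turnstile> CBridge # \<Gamma> \<rhd> IsTy Large A" "R \<turnstile> CTm A # CBridge # \<Gamma> \<rhd> IsTy Large B"
    "R \<turnstile> \<Gamma> \<rhd> HasTm F (Pi (inst A (BEnd E0)) (inst_under B (BEnd E0)))"
    "R \<turnstile> \<Gamma> \<rhd> HasTm F' (Pi (inst A (BEnd E1)) (inst_under B (BEnd E1)))"
    using assms by (auto simp: pi_data_def)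
  show "wf_ctx R (CBridge # \<Gamma>)" "wf_ctx R (CTm A # CBridge # \<Gamma>)"
    using * by (auto intro: ctx_bridge ctx_tm)
  show **: "R \<turnstile> \<Gamma> \<rhd> IsTy Large (inst A (BEnd \<epsilon>))"
    using substitution[OF wf_sub_bend[OF *(1)] *(2)] by (simp add: inst_def)
  show "wf_ctx R (CTm (inst A (BEnd \<epsilon>)) # \<Gamma>)"
    using * ** by (auto intro: ctx_tm)
  show "R \<turnstile> CTm (inst A (BEnd \<epsilon>)) # \<Gamma> \<rhd> IsTy Large (inst_under B (BEnd \<epsilon>))"
    using substitution[OF wf_sub_up_tm[OF wf_sub_bend[OF *(1)] *(2)] *(3)]
    by (simp add: inst_def inst_under_def)
qed

lemma pi_data_subst:
  assumes "pi_data R \<Gamma> A B F F'" "wf_sub R \<Delta> \<sigma> \<Gamma>"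
  shows "pi_data R \<Delta> (tsubst (up \<sigma>) A) (tsubst (up (up \<sigma>)) B) (tsubst \<sigma> F) (tsubst \<sigma> F')"
proof -
  note d = pi_dataD[OF assms(1)]
  show ?thesis
    using wf_sub_codomain[OF assms(2)] substitution[OF wf_sub_up_bridge[OF assms(2)] d(2)]
      substitution[OF wf_sub_up_tm[OF wf_sub_up_bridge[OF assms(2)] d(2)] d(3)]
      substitution[OF assms(2) d(4)] substitution[OF assms(2) d(5)]
    unfolding pi_data_def by (simp add: subst_simps)
qed

text \<open>This is B[C x/d] over \<Gamma>, x for a bridge \<open>C\<close> of \<Gamma>;
  \<open>along\<close> is the case where \<open>C\<close> is the variable c, see
  \<open>over_along\<close>.\<close>

definition over :: "'c tm \<Rightarrow> 'c tm \<Rightarrow> 'c tm" where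
  "over B C = tsubst (BApp (wk 1 C) (Var 0) .: Var 0 .: (\<lambda>n. Var (Suc n))) B"

lemma wf_sub_over:
  assumes "pi_data R \<Gamma> A B F F'" "R \<turnstile> \<Gamma> \<rhd> HasTm C (Bridge A M N)"
  shows "wf_sub R (CBridge # \<Gamma>) (BApp (wk 1 C) (Var 0) .: Var 0 .: (\<lambda>n. Var (Suc n))) (CTm A # CBridge # \<Gamma>)"
  using bapp_var[OF pi_dataD(1)[OF assms(1)] assms(2)] pi_dataD[OF assms(1)]
  by (auto intro!: sub_tm wf_sub_id)

lemma over_ty:
  assumes "pi_data R \<Gamma> A B F F'" "R \<turnstile> \<Gamma> \<rhd> HasTm C (Bridge A M N)"
  shows "R \<turnstile> CBridge # \<Gamma> \<rhd> IsTy Large (over B C)"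
  using substitution[OF wf_sub_over[OF assms] pi_dataD(3)[OF assms(1)]] by (simp add: over_def)

text \<open>At an endpoint, \<open>over B C\<close> becomes B[C \<epsilon>/d], which agrees with
  B[a/d] only judgmentally and not as raw syntax. Hence the conversions in
  \<open>over_bridge_ty\<close>.\<close>

lemma over_end:
  assumes d: "pi_data R \<Gamma> A B F F'" and C: "R \<turnstile> \<Gamma> \<rhd> HasTm C (Bridge A M N)"
    and a: "R \<turnstile> \<Gamma> \<rhd> HasTm a (inst A (BEnd \<epsilon>))"
    and Ca: "R \<turnstile> \<Gamma> \<rhd> EqTm (BApp C (BEnd \<epsilon>)) a (inst A (BEnd \<epsilon>))"
  shows "R \<turnstile> \<Gamma> \<rhd> EqTy Large (inst (over B C) (BEnd \<epsilon>)) (inst2 B (BEnd \<epsilon>) a)"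
  using scons_subst_eq[OF wf_sub_bend[OF pi_dataD(1)[OF d]] pi_dataD(2)[OF d]
      bapp_end[OF pi_dataD(1)[OF d] C, unfolded inst_def] a[unfolded inst_def] Ca[unfolded inst_def]
      pi_dataD(3)[OF d]]
  by (simp add: subst_simps over_def)

lemma pi_data_app:
  assumes d: "pi_data R \<Gamma> A B F F'"
    and a: "R \<turnstile> \<Gamma> \<rhd> HasTm a (inst A (BEnd E0))" and b: "R \<turnstile> \<Gamma> \<rhd> HasTm b (inst A (BEnd E1))"
  shows "R \<turnstile> \<Gamma> \<rhd> HasTm (App F a) (inst2 B (BEnd E0) a)" "R \<turnstile> \<Gamma> \<rhd> HasTm (App F' b) (inst2 B (BEnd E1) b)"
  using app[OF pi_dataD(4)[OF d] a] app[OF pi_dataD(5)[OF d] b] by (simp_all add: subst_simps)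

lemma over_bridge_ty:
  assumes d: "pi_data R \<Gamma> A B F F'" and C: "R \<turnstile> \<Gamma> \<rhd> HasTm C (Bridge A a b)"
    and a: "R \<turnstile> \<Gamma> \<rhd> HasTm a (inst A (BEnd E0))" and b: "R \<turnstile> \<Gamma> \<rhd> HasTm b (inst A (BEnd E1))"
  shows "R \<turnstile> \<Gamma> \<rhd> IsTy Large (Bridge (over B C) (App F a) (App F' b))"
  using over_ty[OF d C] conv[OF pi_data_app(1)[OF d a b] ty_sym[OF over_end[OF d C a bapp_0[OF C]]]]
    conv[OF pi_data_app(2)[OF d a b] ty_sym[OF over_end[OF d C b bapp_1[OF C]]]]
  by (rule bridge_form)

definition bap :: "'c tm \<Rightarrow> 'c tm \<Rightarrow> 'c tm" where
  "bap Q C = BLam (App (BApp (wk 1 Q) (Var 0)) (BApp (wk 1 C) (Var 0)))"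

lemma pi_ty:
  assumes "pi_data R \<Gamma> A B F F'"
  shows "R \<turnstile> \<Gamma> \<rhd> IsTy Large (Bridge (Pi A B) F F')"
  using pi_form[OF pi_dataD(2,3)[OF assms]] pi_dataD(4,5)[OF assms]
  by (intro bridge_form) (simp_all add: subst_simps)

text \<open>The bridge variable occurs twice in the term, but each application only asks its own
  bridge, \<open>Q\<close> or \<open>C\<close>, to be apart from that variable; no contraction is
  involved.\<close>

lemma bap_body:
  assumes d: "pi_data R \<Gamma> A B F F'" and Q: "R \<turnstile> \<Gamma> \<rhd> HasTm Q (Bridge (Pi A B) F F')"
    and C: "R \<turnstile> \<Gamma> \<rhd> HasTm C (Bridge A a b)"
  shows "R \<turnstile> CBridge # \<Gamma> \<rhd> HasTm (App (BApp (wk 1 Q) (Var 0)) (BApp (wk 1 C) (Var 0))) (over B C)"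
  using app[OF bapp_var[OF pi_dataD(1)[OF d] Q] bapp_var[OF pi_dataD(1)[OF d] C]]
  by (simp add: subst_simps over_def)

lemma bap_end:
  assumes Q: "R \<turnstile> \<Gamma> \<rhd> EqTm (BApp Q (BEnd \<epsilon>)) G (Pi (inst A (BEnd \<epsilon>)) (inst_under B (BEnd \<epsilon>)))"
    and C: "R \<turnstile> \<Gamma> \<rhd> EqTm (BApp C (BEnd \<epsilon>)) a (inst A (BEnd \<epsilon>))"
  shows "R \<turnstile> \<Gamma> \<rhd> EqTm (inst (App (BApp (wk 1 Q) (Var 0)) (BApp (wk 1 C) (Var 0))) (BEnd \<epsilon>)) (App G a)
    (inst (over B C) (BEnd \<epsilon>))"
  using app_eq[OF Q C] by (simp add: subst_simps over_def)

lemma bap_ends: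
  assumes d: "pi_data R \<Gamma> A B F F'" and Q: "R \<turnstile> \<Gamma> \<rhd> HasTm Q (Bridge (Pi A B) F F')"
    and C: "R \<turnstile> \<Gamma> \<rhd> HasTm C (Bridge A a b)"
  shows "R \<turnstile> \<Gamma> \<rhd> EqTm (inst (App (BApp (wk 1 Q) (Var 0)) (BApp (wk 1 C) (Var 0))) (BEnd E0)) (App F a)
      (inst (over B C) (BEnd E0))"
    and "R \<turnstile> \<Gamma> \<rhd> EqTm (inst (App (BApp (wk 1 Q) (Var 0)) (BApp (wk 1 C) (Var 0))) (BEnd E1)) (App F' b)
      (inst (over B C) (BEnd E1))"
proof -
  have "R \<turnstile> \<Gamma> \<rhd> EqTm (BApp Q (BEnd E0)) F (Pi (inst A (BEnd E0)) (inst_under B (BEnd E0)))"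
    using bapp_0[OF Q] by (simp add: subst_simps)
  then show "R \<turnstile> \<Gamma> \<rhd> EqTm (inst (App (BApp (wk 1 Q) (Var 0)) (BApp (wk 1 C) (Var 0))) (BEnd E0)) (App F a)
      (inst (over B C) (BEnd E0))"
    by (rule bap_end[OF _ bapp_0[OF C]])
  have "R \<turnstile> \<Gamma> \<rhd> EqTm (BApp Q (BEnd E1)) F' (Pi (inst A (BEnd E1)) (inst_under B (BEnd E1)))"
    using bapp_1[OF Q] by (simp add: subst_simps)
  then show "R \<turnstile> \<Gamma> \<rhd> EqTm (inst (App (BApp (wk 1 Q) (Var 0)) (BApp (wk 1 C) (Var 0))) (BEnd E1)) (App F' b)
      (inst (over B C) (BEnd E1))"
    by (rule bap_end[OF _ bapp_1[OF C]])
qed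

lemma bap_ty:
  assumes d: "pi_data R \<Gamma> A B F F'" and Q: "R \<turnstile> \<Gamma> \<rhd> HasTm Q (Bridge (Pi A B) F F')"
    and C: "R \<turnstile> \<Gamma> \<rhd> HasTm C (Bridge A a b)"
  shows "R \<turnstile> \<Gamma> \<rhd> HasTm (bap Q C) (Bridge (over B C) (App F a) (App F' b))"
  unfolding bap_def by (intro blam bap_body[OF assms] bap_ends[OF assms])

section \<open>Functions of three arguments, and the target type\<close>

abbreviation ap3 :: "'c tm \<Rightarrow> 'c tm \<Rightarrow> 'c tm \<Rightarrow> 'c tm \<Rightarrow> 'c tm" where
  "ap3 H a b c \<equiv> App (App (App H a) b) c"

text \<open>Iterated \<eta>; together with \<open>lam3_eq\<close> it reduces an equation in
  \<open>rel_ty\<close> to one at generic arguments.\<close>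

lemma lam3_eta:
  assumes ctx: "wf_ctx R (CTm A3 # CTm A2 # CTm A1 # \<Gamma>)"
    and H: "R \<turnstile> \<Gamma> \<rhd> HasTm H (Pi A1 (Pi A2 (Pi A3 B)))"
  shows "R \<turnstile> \<Gamma> \<rhd> EqTm H (Lam (Lam (Lam (ap3 (wk 3 H) (Var 2) (Var 1) (Var 0))))) (Pi A1 (Pi A2 (Pi A3 B)))"
proof -
  have A2: "wf_ctx R (CTm A2 # CTm A1 # \<Gamma>)" "R \<turnstile> CTm A1 # \<Gamma> \<rhd> IsTy Large A2"
    and A1: "wf_ctx R (CTm A1 # \<Gamma>)" "R \<turnstile> \<Gamma> \<rhd> IsTy Large A1"
    using ctx by (auto elim!: wf_ctx_tmE)
  note h1 = app_var[OF A1(1) H] and h2 = app_var[OF A2(1) app_var[OF A1(1) H]]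
  have "R \<turnstile> CTm A1 # \<Gamma> \<rhd> EqTm (App (wk 1 H) (Var 0))
      (Lam (Lam (App (wk 1 (App (wk 1 (App (wk 1 H) (Var 0))) (Var 0))) (Var 0)))) (Pi A2 (Pi A3 B))"
    by (rule tm_trans[OF pi_eta[OF h1] lam_eq[OF A2(2) pi_eta[OF h2]]])
  from tm_trans[OF pi_eta[OF H] lam_eq[OF A1(2) this]] show ?thesis
    by (simp add: subst_simps)
qed

lemma lam3_beta_var:
  assumes ctx: "wf_ctx R (CTm A3 # CTm A2 # CTm A1 # \<Gamma>)"
    and M: "R \<turnstile> CTm A3 # CTm A2 # CTm A1 # \<Gamma> \<rhd> HasTm M B"
  shows "R \<turnstile> CTm A3 # CTm A2 # CTm A1 # \<Gamma> \<rhd>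
    EqTm (ap3 (wk 3 (Lam (Lam (Lam M)))) (Var 2) (Var 1) (Var 0)) M B"
proof -
  have A3: "R \<turnstile> CTm A2 # CTm A1 # \<Gamma> \<rhd> IsTy Large A3"
    and A2: "wf_ctx R (CTm A2 # CTm A1 # \<Gamma>)" "R \<turnstile> CTm A1 # \<Gamma> \<rhd> IsTy Large A2"
    and A1: "wf_ctx R (CTm A1 # \<Gamma>)" "R \<turnstile> \<Gamma> \<rhd> IsTy Large A1"
    using ctx by (auto elim!: wf_ctx_tmE)
  note m2 = lam[OF A3 M] and m1 = lam[OF A2(2) lam[OF A3 M]]
  note e1 = app_var_eq[OF A2(1) pi_beta_var[OF A1 m1]]
  note e2 = app_var_eq[OF ctx tm_trans[OF e1 pi_beta_var[OF A2 m2]]]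
  show ?thesis using tm_trans[OF e2 pi_beta_var[OF ctx A3 M]] by (simp add: subst_simps)
qed

definition edge_ctx :: "'c tm \<Rightarrow> 'c ctx \<Rightarrow> 'c ctx" where
  "edge_ctx A \<Gamma> = CTm (edge A) # CTm (wk 1 (inst A (BEnd E1))) # CTm (inst A (BEnd E0)) # \<Gamma>"

definition rel_body :: "'c tm \<Rightarrow> 'c tm \<Rightarrow> 'c tm \<Rightarrow> 'c tm" where
  "rel_body B F F' = Bridge (along B) (App (wk 3 F) (Var 2)) (App (wk 3 F') (Var 1))"

definition rel_ty :: "'c tm \<Rightarrow> 'c tm \<Rightarrow> 'c tm \<Rightarrow> 'c tm \<Rightarrow> 'c tm" where
  "rel_ty A B F F' = Pi (inst A (BEnd E0)) (Pi (wk 1 (inst A (BEnd E1))) (Pi (edge A) (rel_body B F F')))"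

lemma rel_ty_subst:
  "tsubst \<sigma> (rel_ty A B F F') = rel_ty (tsubst (up \<sigma>) A) (tsubst (up (up \<sigma>)) B) (tsubst \<sigma> F) (tsubst \<sigma> F')"
  by (simp add: rel_ty_def rel_body_def subst_simps)

lemma edge_ctx_wf:
  assumes d: "pi_data R \<Gamma> A B F F'"
  shows "R \<turnstile> CTm (inst A (BEnd E0)) # \<Gamma> \<rhd> IsTy Large (wk 1 (inst A (BEnd E1)))"
    "R \<turnstile> CTm (wk 1 (inst A (BEnd E1))) # CTm (inst A (BEnd E0)) # \<Gamma> \<rhd> IsTy Large (edge A)"
    "wf_ctx R (edge_ctx A \<Gamma>)"
proof -
  let ?\<Gamma>1 = "CTm (inst A (BEnd E0)) # \<Gamma>"
  let ?\<Gamma>2 = "CTm (wk 1 (inst A (BEnd E1))) # ?\<Gamma>1"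
  note c1 = pi_dataD(9)[OF d]
  show t2: "R \<turnstile> ?\<Gamma>1 \<rhd> IsTy Large (wk 1 (inst A (BEnd E1)))"
    using weaken[OF c1 pi_dataD(8)[OF d]] by (simp add: ren_eq_tsubst)
  have c2: "wf_ctx R ?\<Gamma>2" by (rule ctx_tm[OF c1 t2])
  have s: "wf_sub R ?\<Gamma>2 (\<lambda>n. Var (n + 2)) \<Gamma>"
    by (rule wf_sub_thin[OF c2 pi_dataD(1)[OF d]]) auto
  have "R \<turnstile> CBridge # ?\<Gamma>2 \<rhd> IsTy Large (ren (upr (\<lambda>n. n + 2)) A)"
    using substitution[OF wf_sub_up_bridge[OF s] pi_dataD(2)[OF d]] by (simp add: subst_simps)
  moreover have "R \<turnstile> ?\<Gamma>2 \<rhd> HasTm (Var 1) (inst (ren (upr (\<lambda>n. n + 2)) A) (BEnd E0))"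
    using variable[OF c2, of 1] by (simp add: subst_simps)
  moreover have "R \<turnstile> ?\<Gamma>2 \<rhd> HasTm (Var 0) (inst (ren (upr (\<lambda>n. n + 2)) A) (BEnd E1))"
    using variable[OF c2, of 0] by (simp add: subst_simps)
  ultimately show t3: "R \<turnstile> ?\<Gamma>2 \<rhd> IsTy Large (edge A)"
    unfolding edge_def by (rule bridge_form)
  show "wf_ctx R (edge_ctx A \<Gamma>)"
    unfolding edge_ctx_def by (rule ctx_tm[OF c2 t3])
qed

text \<open>The three new variables form a boundary pair and a bridge for the data weakened by 3, so
  statements about arbitrary a, b and C specialize to \<open>Var 2\<close>, \<open>Var 1\<close> and
  \<open>Var 0\<close>.\<close>

lemma edge_ctx_data:
  fixes A :: "'c tm"
  defines "A' \<equiv> tsubst (up (\<lambda>n. Var (n + 3))) A"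
  assumes d: "pi_data R \<Gamma> A B F F'"
  shows "wf_sub R (edge_ctx A \<Gamma>) (\<lambda>n. Var (n + 3)) \<Gamma>"
    "pi_data R (edge_ctx A \<Gamma>) A' (tsubst (up (up (\<lambda>n. Var (n + 3)))) B) (wk 3 F) (wk 3 F')"
    "R \<turnstile> edge_ctx A \<Gamma> \<rhd> HasTm (Var 2) (inst A' (BEnd E0))"
    "R \<turnstile> edge_ctx A \<Gamma> \<rhd> HasTm (Var 1) (inst A' (BEnd E1))"
    "R \<turnstile> edge_ctx A \<Gamma> \<rhd> HasTm (Var 0) (Bridge A' (Var 2) (Var 1))"
proof -
  note c = edge_ctx_wf(3)[OF d]
  show s: "wf_sub R (edge_ctx A \<Gamma>) (\<lambda>n. Var (n + 3)) \<Gamma>"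
    by (rule wf_sub_thin[OF c pi_dataD(1)[OF d]]) (auto simp: edge_ctx_def)
  show "pi_data R (edge_ctx A \<Gamma>) A' (tsubst (up (up (\<lambda>n. Var (n + 3)))) B) (wk 3 F) (wk 3 F')"
    using pi_data_subst[OF d s] by (simp add: A'_def ren_eq_tsubst)
  show "R \<turnstile> edge_ctx A \<Gamma> \<rhd> HasTm (Var 2) (inst A' (BEnd E0))"
    using variable[OF c, of 2] by (simp add: edge_ctx_def A'_def subst_simps)
  show "R \<turnstile> edge_ctx A \<Gamma> \<rhd> HasTm (Var 1) (inst A' (BEnd E1))"
    using variable[OF c, of 1] by (simp add: edge_ctx_def A'_def subst_simps)
  show "R \<turnstile> edge_ctx A \<Gamma> \<rhd> HasTm (Var 0) (Bridge A' (Var 2) (Var 1))"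
    using variable[OF c, of 0] by (simp add: edge_ctx_def A'_def subst_simps)
qed

lemma over_along: "over (tsubst (up (up (\<lambda>n. Var (n + 3)))) B) (Var 0) = along B"
  by (simp add: over_def subst_simps)

lemma lam3:
  assumes d: "pi_data R \<Gamma> A B F F'" and M: "R \<turnstile> edge_ctx A \<Gamma> \<rhd> HasTm M T"
  shows "R \<turnstile> \<Gamma> \<rhd> HasTm (Lam (Lam (Lam M))) (Pi (inst A (BEnd E0)) (Pi (wk 1 (inst A (BEnd E1))) (Pi (edge A) T)))"
  using assms by (intro lam pi_dataD edge_ctx_wf) (simp_all add: edge_ctx_def)

lemma lam3_eq:
  assumes d: "pi_data R \<Gamma> A B F F'" and M: "R \<turnstile> edge_ctx A \<Gamma> \<rhd> EqTm M M' T"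
  shows "R \<turnstile> \<Gamma> \<rhd> EqTm (Lam (Lam (Lam M))) (Lam (Lam (Lam M'))) (Pi (inst A (BEnd E0)) (Pi (wk 1 (inst A (BEnd E1))) (Pi (edge A) T)))"
  using assms by (intro lam_eq pi_dataD edge_ctx_wf) (simp_all add: edge_ctx_def)

lemma rel_ty_ty:
  assumes d: "pi_data R \<Gamma> A B F F'"
  shows "R \<turnstile> \<Gamma> \<rhd> IsTy Large (rel_ty A B F F')"
proof -
  note e = edge_ctx_data[OF d]
  have "R \<turnstile> edge_ctx A \<Gamma> \<rhd> IsTy Large (rel_body B F F')"
    using over_bridge_ty[OF e(2,5,3,4)] unfolding over_along rel_body_def .
  then show ?thesis
    unfolding rel_ty_def edge_ctx_def by (intro pi_form pi_dataD(8)[OF d] edge_ctx_wf[OF d])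
qed

lemma ap3_eq:
  assumes H: "R \<turnstile> \<Gamma> \<rhd> EqTm H H' (rel_ty A B F F')" and a: "R \<turnstile> \<Gamma> \<rhd> EqTm a a' (inst A (BEnd E0))"
    and b: "R \<turnstile> \<Gamma> \<rhd> EqTm b b' (inst A (BEnd E1))" and C: "R \<turnstile> \<Gamma> \<rhd> EqTm C C' (Bridge A a b)"
  shows "R \<turnstile> \<Gamma> \<rhd> EqTm (ap3 H a b C) (ap3 H' a' b' C') (Bridge (over B C) (App F a) (App F' b))"
proof -
  \<comment> \<open>The domain is evaluated to the type of \<open>b\<close>, while the codomain
    stays a pending substitution that the next application extends.\<close>
  have "R \<turnstile> \<Gamma> \<rhd> EqTm (App H a) (App H' a') (Pi (inst A (BEnd E1))
     (tsubst (up (a .: Var)) (Pi (edge A) (rel_body B F F'))))"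
    using app_eq[OF H[unfolded rel_ty_def] a] by (simp add: subst_simps)
  from app_eq[OF this b]
  have "R \<turnstile> \<Gamma> \<rhd> EqTm (App (App H a) b) (App (App H' a') b') (Pi (Bridge A a b)
     (tsubst (up (b .: a .: Var)) (rel_body B F F')))"
    by (simp add: subst_simps)
  from app_eq[OF this C] show ?thesis by (simp add: over_def rel_body_def subst_simps)
qed

lemma ap3_ty:
  assumes H: "R \<turnstile> \<Gamma> \<rhd> HasTm H (rel_ty A B F F')" and a: "R \<turnstile> \<Gamma> \<rhd> HasTm a (inst A (BEnd E0))"
    and b: "R \<turnstile> \<Gamma> \<rhd> HasTm b (inst A (BEnd E1))" and C: "R \<turnstile> \<Gamma> \<rhd> HasTm C (Bridge A a b)"
  shows "R \<turnstile> \<Gamma> \<rhd> HasTm (ap3 H a b C) (Bridge (over B C) (App F a) (App F' b))"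
proof -
  have "R \<turnstile> \<Gamma> \<rhd> HasTm (App H a) (Pi (inst A (BEnd E1))
     (tsubst (up (a .: Var)) (Pi (edge A) (rel_body B F F'))))"
    using app[OF H[unfolded rel_ty_def] a] by (simp add: subst_simps)
  from app[OF this b]
  have "R \<turnstile> \<Gamma> \<rhd> HasTm (App (App H a) b) (Pi (Bridge A a b)
     (tsubst (up (b .: a .: Var)) (rel_body B F F')))"
    by (simp add: subst_simps)
  from app[OF this C] show ?thesis by (simp add: over_def rel_body_def subst_simps)
qed

lemma ap3_var:
  assumes d: "pi_data R \<Gamma> A B F F'" and H: "R \<turnstile> \<Gamma> \<rhd> HasTm H (rel_ty A B F F')"
  shows "R \<turnstile> edge_ctx A \<Gamma> \<rhd> HasTm (ap3 (wk 3 H) (Var 2) (Var 1) (Var 0)) (rel_body B F F')"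
proof -
  note e = edge_ctx_data[OF d]
  show ?thesis
    using ap3_ty[OF substitution[OF e(1) H, unfolded jsubst.simps rel_ty_subst] e(3,4,5)]
    unfolding over_along rel_body_def ren_eq_tsubst .
qed

section \<open>From bridges of functions to pointwise bridges\<close>

definition fwd :: "'c tm \<Rightarrow> 'c tm" where
  "fwd Q = Lam (Lam (Lam (bap (wk 3 Q) (Var 0))))"

lemma fwd_body:
  assumes d: "pi_data R \<Gamma> A B F F'" and Q: "R \<turnstile> \<Gamma> \<rhd> HasTm Q (Bridge (Pi A B) F F')"
  shows "R \<turnstile> edge_ctx A \<Gamma> \<rhd> HasTm (bap (wk 3 Q) (Var 0)) (rel_body B F F')"
proof -
  note e = edge_ctx_data[OF d]
  have "R \<turnstile> edge_ctx A \<Gamma> \<rhd> HasTm (wk 3 Q)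
    (Bridge (Pi (tsubst (up (\<lambda>n. Var (n + 3))) A) (tsubst (up (up (\<lambda>n. Var (n + 3)))) B)) (wk 3 F) (wk 3 F'))"
    using substitution[OF e(1) Q] by (simp add: subst_simps)
  from bap_ty[OF e(2) this e(5)] show ?thesis
    unfolding over_along rel_body_def .
qed

lemma fwd_ty:
  assumes d: "pi_data R \<Gamma> A B F F'" and Q: "R \<turnstile> \<Gamma> \<rhd> HasTm Q (Bridge (Pi A B) F F')"
  shows "R \<turnstile> \<Gamma> \<rhd> HasTm (fwd Q) (rel_ty A B F F')"
  unfolding fwd_def rel_ty_def by (rule lam3[OF d fwd_body[OF assms]])

lemma ap3_fwd:
  assumes d: "pi_data R \<Gamma> A B F F'" and Q: "R \<turnstile> \<Gamma> \<rhd> HasTm Q (Bridge (Pi A B) F F')"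
  shows "R \<turnstile> edge_ctx A \<Gamma> \<rhd> EqTm (ap3 (wk 3 (fwd Q)) (Var 2) (Var 1) (Var 0)) (bap (wk 3 Q) (Var 0)) (rel_body B F F')"
  using edge_ctx_wf(3)[OF d] fwd_body[OF assms] unfolding fwd_def edge_ctx_def by (rule lam3_beta_var)

section \<open>The inverse map, by extent\<close>

definition extent_at :: "'c tm \<Rightarrow> 'c tm \<Rightarrow> 'c tm \<Rightarrow> 'c tm \<Rightarrow> 'c tm \<Rightarrow> 'c tm" where
  "extent_at F F' H r M = Extent r M (App (wk 1 F) (Var 0)) (App (wk 1 F') (Var 0))
    (ap3 (wk 3 H) (Var 2) (Var 1) (Var 0))"

text \<open>The shape in which \<open>extent_premises\<close> asks for the type of the third branch:
  its endpoints have to be the first two branches, at a and at a'.\<close>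

lemma rel_body_eq:
  "rel_body B F F' = Bridge (along B) (tsubst (Var 2 .: (\<lambda>n. Var (n + 3))) (App (wk 1 F) (Var 0)))
    (tsubst (Var 1 .: (\<lambda>n. Var (n + 3))) (App (wk 1 F') (Var 0)))"
  by (simp add: rel_body_def subst_simps)

lemma extent_at_premises:
  assumes d: "pi_data R \<Gamma> A B F F'" and H: "R \<turnstile> \<Gamma> \<rhd> HasTm H (rel_ty A B F F')"
  shows "\<forall>\<Delta> K. (\<Delta>, K) \<in> extent_premises \<Gamma> A B (App (wk 1 F) (Var 0)) (App (wk 1 F') (Var 0))
    (ap3 (wk 3 H) (Var 2) (Var 1) (Var 0)) \<longrightarrow> R \<turnstile> \<Delta> \<rhd> K"
  using ap3_var[OF assms] pi_dataD(2,3)[OF d] app_var[OF pi_dataD(9)[OF d] pi_dataD(4)[OF d]]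
    app_var[OF pi_dataD(9)[OF d] pi_dataD(5)[OF d]]
  unfolding extent_premises_def edge_ctx_def rel_body_eq by blast

lemma extent_at_ty:
  assumes "wf_ctx R \<Theta>" "bdim \<Theta> r" "pi_data R (apart \<Theta> r) A B F F'"
    "R \<turnstile> apart \<Theta> r \<rhd> HasTm H (rel_ty A B F F')" "R \<turnstile> \<Theta> \<rhd> HasTm M (inst A r)"
  shows "R \<turnstile> \<Theta> \<rhd> HasTm (extent_at F F' H r M) (inst2 B r M)"
  unfolding extent_at_def using assms(1,2,5) extent_at_premises[OF assms(3,4)] by (rule extent)

definition bwd_body :: "'c tm \<Rightarrow> 'c tm \<Rightarrow> 'c tm \<Rightarrow> 'c tm" where
  "bwd_body F F' H = extent_at (wk 2 F) (wk 2 F') (wk 2 H) (Var 1) (Var 0)"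

definition bwd :: "'c tm \<Rightarrow> 'c tm \<Rightarrow> 'c tm \<Rightarrow> 'c tm" where
  "bwd F F' H = BLam (Lam (bwd_body F F' H))"

text \<open>Over x and m : A, being apart from x withdraws m as well, because m is declared after x.
  The branches of the extent are thus typed over extensions of
  \<open>Hidden # Hidden # \<Gamma>\<close>, while its argument m may use the full context.
  Instantiated at x and m, the weakened \<open>B\<close> is \<open>B\<close> again.\<close>

lemma fun_ctx_data:
  fixes A :: "'c tm"
  defines "A' \<equiv> tsubst (up (\<lambda>n. Var (n + 2))) A"
  assumes d: "pi_data R \<Gamma> A B F F'"
  shows "wf_sub R (Hidden # Hidden # \<Gamma>) (\<lambda>n. Var (n + 2)) \<Gamma>"
    "pi_data R (Hidden # Hidden # \<Gamma>) A' (tsubst (up (up (\<lambda>n. Var (n + 2)))) B) (wk 2 F) (wk 2 F')"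
    "bdim (CTm A # CBridge # \<Gamma>) (Var 1)"
    "R \<turnstile> CTm A # CBridge # \<Gamma> \<rhd> HasTm (Var 0) (inst A' (Var 1))"
    "inst2 (tsubst (up (up (\<lambda>n. Var (n + 2)))) B) (Var 1) (Var 0) = B"
proof -
  have "wf_ctx R (Hidden # Hidden # \<Gamma>)" by (intro ctx_hidden pi_dataD(1)[OF d])
  then show s: "wf_sub R (Hidden # Hidden # \<Gamma>) (\<lambda>n. Var (n + 2)) \<Gamma>"
    by (rule wf_sub_thin[OF _ pi_dataD(1)[OF d]]) auto
  show "pi_data R (Hidden # Hidden # \<Gamma>) A' (tsubst (up (up (\<lambda>n. Var (n + 2)))) B) (wk 2 F) (wk 2 F')"
    using pi_data_subst[OF d s] by (simp add: A'_def ren_eq_tsubst)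
  show "bdim (CTm A # CBridge # \<Gamma>) (Var 1)" by (simp add: bdim_def)
  show "R \<turnstile> CTm A # CBridge # \<Gamma> \<rhd> HasTm (Var 0) (inst A' (Var 1))"
    using variable_0[OF pi_dataD(7)[OF d]] by (simp add: A'_def subst_simps)
  show "inst2 (tsubst (up (up (\<lambda>n. Var (n + 2)))) B) (Var 1) (Var 0) = B"
    by (simp add: subst_simps)
qed

lemma apart_fun_ctx: "apart (CTm A # CBridge # \<Gamma>) (Var 1) = Hidden # Hidden # \<Gamma>"
  by simp

lemma bwd_body_ty:
  assumes d: "pi_data R \<Gamma> A B F F'" and H: "R \<turnstile> \<Gamma> \<rhd> HasTm H (rel_ty A B F F')"
  shows "R \<turnstile> CTm A # CBridge # \<Gamma> \<rhd> HasTm (bwd_body F F' H) B"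
proof -
  note e = fun_ctx_data[OF d]
  have "R \<turnstile> Hidden # Hidden # \<Gamma> \<rhd> HasTm (wk 2 H) (rel_ty (tsubst (up (\<lambda>n. Var (n + 2))) A)
      (tsubst (up (up (\<lambda>n. Var (n + 2)))) B) (wk 2 F) (wk 2 F'))"
    using substitution[OF e(1) H] by (simp add: rel_ty_subst ren_eq_tsubst)
  from extent_at_ty[OF pi_dataD(7)[OF d] e(3) _ _ e(4), unfolded apart_fun_ctx, OF e(2) this]
  show ?thesis unfolding bwd_body_def e(5) .
qed

lemma bwd_lam_ty:
  assumes d: "pi_data R \<Gamma> A B F F'" and H: "R \<turnstile> \<Gamma> \<rhd> HasTm H (rel_ty A B F F')"
  shows "R \<turnstile> CBridge # \<Gamma> \<rhd> HasTm (Lam (bwd_body F F' H)) (Pi A B)"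
  by (rule lam[OF pi_dataD(2)[OF d] bwd_body_ty[OF assms]])

text \<open>At an endpoint of x the extent reduces to its branch, \<open>F\<close> or
  \<open>F'\<close> applied to the bound variable, and \<eta> for functions contracts the
  abstraction.\<close>

lemma bwd_ends:
  assumes d: "pi_data R \<Gamma> A B F F'" and H: "R \<turnstile> \<Gamma> \<rhd> HasTm H (rel_ty A B F F')"
  shows "R \<turnstile> \<Gamma> \<rhd> EqTm (inst (Lam (bwd_body F F' H)) (BEnd E0)) F (inst (Pi A B) (BEnd E0))"
    and "R \<turnstile> \<Gamma> \<rhd> EqTm (inst (Lam (bwd_body F F' H)) (BEnd E1)) F' (inst (Pi A B) (BEnd E1))"
proof -
  have *: "R \<turnstile> CTm (inst A (BEnd \<epsilon>)) # \<Gamma> \<rhd> HasTm (Var 0) (inst (tsubst (up (\<lambda>n. Var (Suc n))) A) (BEnd \<epsilon>))"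
    "pi_data R (CTm (inst A (BEnd \<epsilon>)) # \<Gamma>) (tsubst (up (\<lambda>n. Var (Suc n))) A)
       (tsubst (up (up (\<lambda>n. Var (Suc n)))) B) (wk 1 F) (wk 1 F')"
    "R \<turnstile> CTm (inst A (BEnd \<epsilon>)) # \<Gamma> \<rhd> HasTm (wk 1 H) (rel_ty (tsubst (up (\<lambda>n. Var (Suc n))) A)
       (tsubst (up (up (\<lambda>n. Var (Suc n)))) B) (wk 1 F) (wk 1 F'))" for \<epsilon>
    using variable_0[OF pi_dataD(9)[OF d], of \<epsilon>] pi_data_subst[OF d wf_sub_shift[OF pi_dataD(9)[OF d]], of \<epsilon>]
      weaken[OF pi_dataD(9)[OF d] H, of \<epsilon>]
    by (simp_all add: subst_simps rel_ty_subst)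
  have "R \<turnstile> CTm (inst A (BEnd E0)) # \<Gamma> \<rhd> EqTm (inst_under (bwd_body F F' H) (BEnd E0)) (App (wk 1 F) (Var 0))
    (inst_under B (BEnd E0))"
    using extent_0[OF pi_dataD(9)[OF d] *(1) extent_at_premises[OF *(2,3)]]
    by (simp add: subst_simps bwd_body_def extent_at_def)
  from tm_trans[OF lam_eq[OF pi_dataD(8)[OF d] this] tm_sym[OF pi_eta[OF pi_dataD(4)[OF d]]]]
  show "R \<turnstile> \<Gamma> \<rhd> EqTm (inst (Lam (bwd_body F F' H)) (BEnd E0)) F (inst (Pi A B) (BEnd E0))"
    by (simp add: subst_simps)
  have "R \<turnstile> CTm (inst A (BEnd E1)) # \<Gamma> \<rhd> EqTm (inst_under (bwd_body F F' H) (BEnd E1)) (App (wk 1 F') (Var 0))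
    (inst_under B (BEnd E1))"
    using extent_1[OF pi_dataD(9)[OF d] *(1) extent_at_premises[OF *(2,3)]]
    by (simp add: subst_simps bwd_body_def extent_at_def)
  from tm_trans[OF lam_eq[OF pi_dataD(8)[OF d] this] tm_sym[OF pi_eta[OF pi_dataD(5)[OF d]]]]
  show "R \<turnstile> \<Gamma> \<rhd> EqTm (inst (Lam (bwd_body F F' H)) (BEnd E1)) F' (inst (Pi A B) (BEnd E1))"
    by (simp add: subst_simps)
qed

lemma bwd_ty:
  assumes d: "pi_data R \<Gamma> A B F F'" and H: "R \<turnstile> \<Gamma> \<rhd> HasTm H (rel_ty A B F F')"
  shows "R \<turnstile> \<Gamma> \<rhd> HasTm (bwd F F' H) (Bridge (Pi A B) F F')"
  unfolding bwd_def by (rule blam[OF bwd_lam_ty[OF assms] bwd_ends[OF assms]])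

section \<open>The two composites\<close>

lemma fwd_subst: "tsubst \<sigma> (fwd Q) = fwd (tsubst \<sigma> Q)"
  by (simp add: fwd_def bap_def subst_simps)

lemma bwd_subst: "tsubst \<sigma> (bwd F F' H) = bwd (tsubst \<sigma> F) (tsubst \<sigma> F') (tsubst \<sigma> H)"
  by (simp add: bwd_def bwd_body_def extent_at_def subst_simps)

text \<open>Under the bridge abstraction, \<open>e1\<close> is \<beta> for bridges,
  \<open>e2\<close> is \<beta> for functions, \<open>e3\<close> is \<beta> for extent, and
  \<open>e4\<close> cleans up the arguments that the latter produces. A final \<eta> for bridges
  removes the abstraction.\<close>

lemma bap_bwd:
  assumes d: "pi_data R \<Gamma> A B F F'" and H: "R \<turnstile> \<Gamma> \<rhd> HasTm H (rel_ty A B F F')"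
    and a: "R \<turnstile> \<Gamma> \<rhd> HasTm a (inst A (BEnd E0))"
    and b: "R \<turnstile> \<Gamma> \<rhd> HasTm b (inst A (BEnd E1))" and C: "R \<turnstile> \<Gamma> \<rhd> HasTm C (Bridge A a b)"
  shows "R \<turnstile> \<Gamma> \<rhd> EqTm (bap (bwd F F' H) C) (ap3 H a b C) (Bridge (over B C) (App F a) (App F' b))"
proof -
  let ?\<Gamma> = "CBridge # \<Gamma>"
  let ?c = "BApp (wk 1 C) (Var 0)"
  let ?s = "\<lambda>n. Var (Suc n)"
  note wf = pi_dataD(1)[OF d] and c = bapp_var[OF pi_dataD(1)[OF d] C]
  have e1: "R \<turnstile> ?\<Gamma> \<rhd> EqTm (App (BApp (wk 1 (bwd F F' H)) (Var 0)) ?c) (App (Lam (bwd_body F F' H)) ?c) (over B C)"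
    using app_eq[OF bridge_beta_var[OF wf bwd_lam_ty[OF d H]] tm_refl[OF c]]
    by (simp add: bwd_def over_def inst_def)
  have e2: "R \<turnstile> ?\<Gamma> \<rhd> EqTm (App (Lam (bwd_body F F' H)) ?c) (extent_at (wk 1 F) (wk 1 F') (wk 1 H) (Var 0) ?c) (over B C)"
    using pi_beta[OF pi_dataD(2)[OF d] bwd_body_ty[OF d H] c]
    by (simp add: bwd_body_def extent_at_def over_def subst_simps)
  have wfH: "wf_ctx R (Hidden # \<Gamma>)" by (rule ctx_hidden[OF wf])
  have d': "pi_data R (Hidden # \<Gamma>) (tsubst (up ?s) A) (tsubst (up (up ?s)) B) (tsubst ?s F) (tsubst ?s F')"
    by (rule pi_data_subst[OF d wf_sub_shift[OF wfH]])
  have H': "R \<turnstile> Hidden # \<Gamma> \<rhd> HasTm (tsubst ?s H)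
      (rel_ty (tsubst (up ?s) A) (tsubst (up (up ?s)) B) (tsubst ?s F) (tsubst ?s F'))"
    using weaken[OF wfH H] by (simp add: rel_ty_subst)
  have "R \<turnstile> Hidden # \<Gamma> \<rhd> HasTm (wk 1 C) (Bridge (tsubst (up ?s) A) (wk 1 a) (wk 1 b))"
    using weaken[OF wfH C] by (simp add: ren_eq_tsubst)
  \<comment> \<open>The argument C x has to be exhibited as the instance at x of a term in a fresh
    y. That term is C y, typed over y and the context in which x is hidden.\<close>
  from bapp_var[OF wfH this]
  have C': "R \<turnstile> CBridge # apart ?\<Gamma> (Var 0) \<rhd> HasTm (BApp (wk 1 (wk 1 C)) (Var 0)) (tsubst (up ?s) A)"
    by simp
  \<comment> \<open>The arguments that \<beta> for extent produces from C y are its two endpoints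
    and its abstraction. They equal \<open>a\<close>, \<open>b\<close> and \<open>C\<close> by the
    endpoint rules and by \<eta> for bridges.\<close>
  let ?h = "ap3 H (BApp C (BEnd E0)) (BApp C (BEnd E1)) (BLam ?c)"
  have "\<forall>\<Delta> K. (\<Delta>, K) \<in> extent_premises (apart ?\<Gamma> (Var 0)) (tsubst (up ?s) A) (tsubst (up (up ?s)) B)
     (App (wk 1 (tsubst ?s F)) (Var 0)) (App (wk 1 (tsubst ?s F')) (Var 0))
    (ap3 (wk 3 (tsubst ?s H)) (Var 2) (Var 1) (Var 0)) \<longrightarrow> R \<turnstile> \<Delta> \<rhd> K"
    using extent_at_premises[OF d' H'] by simp
  from extent_beta[OF ctx_bridge[OF wf] bdim_0 C' this]
  have e3: "R \<turnstile> ?\<Gamma> \<rhd> EqTm (extent_at (wk 1 F) (wk 1 F') (wk 1 H) (Var 0) ?c) (BApp (wk 1 ?h) (Var 0)) (over B C)"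
    by (simp add: extent_at_def over_def subst_simps)
  have h: "R \<turnstile> \<Gamma> \<rhd> EqTm (ap3 H a b C) ?h (Bridge (over B C) (App F a) (App F' b))"
    by (rule ap3_eq[OF tm_refl[OF H] tm_sym[OF bapp_0[OF C]] tm_sym[OF bapp_1[OF C]] bridge_eta[OF C]])
  have e4: "R \<turnstile> ?\<Gamma> \<rhd> EqTm (BApp (wk 1 ?h) (Var 0)) (BApp (wk 1 (ap3 H a b C)) (Var 0)) (over B C)"
    by (rule bapp_var_eq[OF wf tm_sym[OF h]])
  have "R \<turnstile> \<Gamma> \<rhd> EqTm (bap (bwd F F' H) C) (BLam (BApp (wk 1 (ap3 H a b C)) (Var 0)))
      (Bridge (over B C) (App F a) (App F' b))"
    unfolding bap_def
    by (rule blam_eq[OF tm_trans[OF tm_trans[OF e1 e2] tm_trans[OF e3 e4]] bap_ends[OF d bwd_ty[OF d H] C]])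
  then show ?thesis
    using bridge_eta[OF ap3_ty[OF H a b C]] by (blast intro: tm_trans tm_sym)
qed

lemma fwd_bwd:
  assumes d: "pi_data R \<Gamma> A B F F'" and H: "R \<turnstile> \<Gamma> \<rhd> HasTm H (rel_ty A B F F')"
  shows "R \<turnstile> \<Gamma> \<rhd> EqTm (fwd (bwd F F' H)) H (rel_ty A B F F')"
proof -
  note e = edge_ctx_data[OF d]
  have "R \<turnstile> edge_ctx A \<Gamma> \<rhd> EqTm (bap (wk 3 (bwd F F' H)) (Var 0)) (ap3 (wk 3 H) (Var 2) (Var 1) (Var 0)) (rel_body B F F')"
    using bap_bwd[OF e(2) substitution[OF e(1) H, unfolded jsubst.simps rel_ty_subst, folded ren_eq_tsubst] e(3,4,5)]
    unfolding over_along rel_body_def by (simp only: ren_eq_tsubst bwd_subst)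
  note lam3_eq[OF d this, folded fwd_def rel_ty_def]
  moreover have "R \<turnstile> \<Gamma> \<rhd> EqTm H (Lam (Lam (Lam (ap3 (wk 3 H) (Var 2) (Var 1) (Var 0))))) (rel_ty A B F F')"
    using lam3_eta[OF edge_ctx_wf(3)[OF d, unfolded edge_ctx_def] H[unfolded rel_ty_def]] unfolding rel_ty_def .
  ultimately show ?thesis by (blast intro: tm_trans tm_sym)
qed

text \<open>This is \<eta> for extent at N = (Q x) d, once the branches are rewritten:
  \<open>F\<close> and \<open>F'\<close> are the endpoints of \<open>Q\<close>, and the branch
  through \<open>fwd\<close> reduces to the bridge of N along c. Keeping \<open>\<Theta>\<close> and
  \<open>r\<close> abstract keeps the hidden entries of the intended instance out of the
  argument.\<close>

lemma extent_at_fwd: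
  assumes wf: "wf_ctx R \<Theta>" and r: "bdim \<Theta> r" and d: "pi_data R (apart \<Theta> r) A B F F'"
    and Q: "R \<turnstile> apart \<Theta> r \<rhd> HasTm Q (Bridge (Pi A B) F F')" and M: "R \<turnstile> \<Theta> \<rhd> HasTm M (inst A r)"
  shows "R \<turnstile> \<Theta> \<rhd> EqTm (extent_at F F' (fwd Q) r M) (App (BApp Q r) M) (inst2 B r M)"
proof -
  let ?\<Delta> = "apart \<Theta> r"
  let ?N = "App (wk 1 (BApp (wk 1 Q) (Var 0))) (Var 0)"
  have N: "R \<turnstile> CTm A # CBridge # ?\<Delta> \<rhd> HasTm ?N B"
    by (rule app_var[OF pi_dataD(7)[OF d] bapp_var[OF pi_dataD(1)[OF d] Q]])
  have q0: "R \<turnstile> ?\<Delta> \<rhd> EqTm F (BApp Q (BEnd E0)) (Pi (inst A (BEnd E0)) (inst_under B (BEnd E0)))"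
    using tm_sym[OF bapp_0[OF Q]] by (simp add: subst_simps)
  have q1: "R \<turnstile> ?\<Delta> \<rhd> EqTm F' (BApp Q (BEnd E1)) (Pi (inst A (BEnd E1)) (inst_under B (BEnd E1)))"
    using tm_sym[OF bapp_1[OF Q]] by (simp add: subst_simps)
  \<comment> \<open>The rewritten branches must coincide as raw syntax with those that
    \<open>extent_eta\<close> forms from \<open>?N\<close>.\<close>
  have "App (wk 1 (BApp Q (BEnd \<epsilon>))) (Var 0) = inst_under ?N (BEnd \<epsilon>)" for \<epsilon>
    by (simp add: subst_simps)
  note n = app_var_eq[OF pi_dataD(9)[OF d] q0, unfolded this] app_var_eq[OF pi_dataD(9)[OF d] q1, unfolded this]
  have "bap (wk 3 Q) (Var 0) = BLam (along ?N)"
    by (simp add: bap_def subst_simps)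
  note b = ap3_fwd[OF d Q, unfolded this edge_ctx_def rel_body_eq]
  from tm_trans[OF extent_eq[OF wf r tm_refl[OF M] extent_at_premises[OF d fwd_ty[OF d Q]] n b]
      extent_eta[OF wf r M pi_dataD(2,3)[OF d] N]]
  show ?thesis by (simp add: extent_at_def subst_simps)
qed

lemma bwd_fwd:
  assumes d: "pi_data R \<Gamma> A B F F'" and Q: "R \<turnstile> \<Gamma> \<rhd> HasTm Q (Bridge (Pi A B) F F')"
  shows "R \<turnstile> \<Gamma> \<rhd> EqTm (bwd F F' (fwd Q)) Q (Bridge (Pi A B) F F')"
proof -
  note e = fun_ctx_data[OF d]
  have "R \<turnstile> Hidden # Hidden # \<Gamma> \<rhd> HasTm (wk 2 Q) (Bridge (Pi (tsubst (up (\<lambda>n. Var (n + 2))) A)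
      (tsubst (up (up (\<lambda>n. Var (n + 2)))) B)) (wk 2 F) (wk 2 F'))"
    using substitution[OF e(1) Q] by (simp add: subst_simps)
  \<comment> \<open>The instance in the context \<Gamma>, x, m : A, with \<open>r\<close> the
    variable x and \<open>M\<close> the variable m.\<close>
  from extent_at_fwd[OF pi_dataD(7)[OF d] e(3) _ _ e(4), unfolded apart_fun_ctx, OF e(2) this, unfolded e(5)]
  have "R \<turnstile> CTm A # CBridge # \<Gamma> \<rhd>
      EqTm (bwd_body F F' (fwd Q)) (App (wk 1 (BApp (wk 1 Q) (Var 0))) (Var 0)) B"
    by (simp add: bwd_body_def extent_at_def fwd_subst ren_eq_tsubst eval_nat_numeral)
  from tm_trans[OF lam_eq[OF pi_dataD(2)[OF d] this] tm_sym[OF pi_eta[OF bapp_var[OF pi_dataD(1)[OF d] Q]]]]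
  have "R \<turnstile> CBridge # \<Gamma> \<rhd> EqTm (Lam (bwd_body F F' (fwd Q))) (BApp (wk 1 Q) (Var 0)) (Pi A B)" .
  from tm_trans[OF blam_eq[OF this bwd_ends[OF d fwd_ty[OF d Q]]] tm_sym[OF bridge_eta[OF Q]]]
  show ?thesis unfolding bwd_def .
qed

section \<open>Equivalences from judgmental isomorphisms\<close>

lemma arrow_ty:
  assumes "wf_ctx R \<Gamma>" "R \<turnstile> \<Gamma> \<rhd> IsTy Large X" "R \<turnstile> \<Gamma> \<rhd> IsTy Large Y"
  shows "R \<turnstile> \<Gamma> \<rhd> IsTy Large (Arrow X Y)" "wf_ctx R (CTm (Arrow X Y) # \<Gamma>)"
proof -
  show "R \<turnstile> \<Gamma> \<rhd> IsTy Large (Arrow X Y)"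
    using weaken[OF ctx_tm[OF assms(1,2)] assms(3)] assms(2)
    unfolding Arrow_def by (intro pi_form) (simp_all add: ren_eq_tsubst)
  then show "wf_ctx R (CTm (Arrow X Y) # \<Gamma>)" by (rule ctx_tm[OF assms(1)])
qed

lemma path_in_ty:
  assumes "wf_ctx R \<Gamma>" "R \<turnstile> \<Gamma> \<rhd> IsTy Large X" "R \<turnstile> \<Gamma> \<rhd> HasTm M X" "R \<turnstile> \<Gamma> \<rhd> HasTm N X"
  shows "R \<turnstile> \<Gamma> \<rhd> IsTy Large (PathIn X M N)"
  using weaken[OF ctx_path[OF assms(1)] assms(2)] assms(3,4)
  unfolding PathIn_def by (intro path_form) (simp_all add: subst_simps)

lemma app_arrow:
  assumes "R \<turnstile> \<Gamma> \<rhd> HasTm f (Arrow X Y)" "R \<turnstile> \<Gamma> \<rhd> HasTm M X"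
  shows "R \<turnstile> \<Gamma> \<rhd> HasTm (App f M) Y"
  using app[OF assms(1)[unfolded Arrow_def] assms(2)] by (simp add: subst_simps)

text \<open>Lives over one further variable, the candidate inverse, which becomes
  \<open>Var 1\<close> under the \<open>Pi\<close>; \<open>Y\<close> and \<open>f\<close> come from
  the smaller context, hence their weakenings. The same holds for \<open>left_inv\<close>.\<close>

definition right_inv :: "'c tm \<Rightarrow> 'c tm \<Rightarrow> 'c tm" where
  "right_inv Y f = Pi (wk 1 Y) (PathIn (wk 2 Y) (App (wk 2 f) (App (Var 1) (Var 0))) (Var 0))"

definition left_inv :: "'c tm \<Rightarrow> 'c tm \<Rightarrow> 'c tm" where
  "left_inv X f = Pi (wk 1 X) (PathIn (wk 2 X) (App (Var 1) (App (wk 2 f) (Var 0))) (Var 0))"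

lemma inv_ty:
  assumes wf: "wf_ctx R \<Gamma>" and X: "R \<turnstile> \<Gamma> \<rhd> IsTy Large X" and Y: "R \<turnstile> \<Gamma> \<rhd> IsTy Large Y"
    and f: "R \<turnstile> \<Gamma> \<rhd> HasTm f (Arrow X Y)"
  shows "R \<turnstile> CTm (Arrow Y X) # \<Gamma> \<rhd> IsTy Large (right_inv Y f)"
    "R \<turnstile> CTm (Arrow Y X) # \<Gamma> \<rhd> IsTy Large (left_inv X f)"
proof -
  note c1 = arrow_ty(2)[OF wf Y X]
  \<comment> \<open>One statement serves both homotopies: \<open>Z\<close> is \<open>Y\<close> for
    the right inverse and \<open>X\<close> for the left one.\<close>
  have inv: "R \<turnstile> CTm (Arrow Y X) # \<Gamma> \<rhd> IsTy Large (wk 1 Z) \<and> wf_ctx R \<Delta> \<and> R \<turnstile> \<Delta> \<rhd> HasTm (Var 0) (wk 2 Z) \<and>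
      R \<turnstile> \<Delta> \<rhd> HasTm (Var 1) (Arrow (wk 2 Y) (wk 2 X)) \<and> R \<turnstile> \<Delta> \<rhd> HasTm (wk 2 f) (Arrow (wk 2 X) (wk 2 Y)) \<and>
      R \<turnstile> \<Delta> \<rhd> IsTy Large (wk 2 Z)"
    if Z: "R \<turnstile> \<Gamma> \<rhd> IsTy Large Z" and \<Delta>: "\<Delta> = CTm (wk 1 Z) # CTm (Arrow Y X) # \<Gamma>" for Z \<Delta>
  proof -
    have Z1: "R \<turnstile> CTm (Arrow Y X) # \<Gamma> \<rhd> IsTy Large (wk 1 Z)"
      using weaken[OF c1 Z] by (simp add: ren_eq_tsubst)
    have c2: "wf_ctx R \<Delta>" unfolding \<Delta> by (rule ctx_tm[OF c1 Z1])
    have s: "wf_sub R \<Delta> (\<lambda>n. Var (n + 2)) \<Gamma>"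
      by (rule wf_sub_thin[OF c2 wf]) (auto simp: \<Delta>)
    show ?thesis
      using Z1 c2 substitution[OF s Z] substitution[OF s f] variable[OF c2, of 0] variable[OF c2, of 1]
      by (simp add: \<Delta> Arrow_def subst_simps)
  qed
  show "R \<turnstile> CTm (Arrow Y X) # \<Gamma> \<rhd> IsTy Large (right_inv Y f)"
    using inv[OF Y refl] unfolding right_inv_def by (blast intro: pi_form path_in_ty app_arrow)
  show "R \<turnstile> CTm (Arrow Y X) # \<Gamma> \<rhd> IsTy Large (left_inv X f)"
    using inv[OF X refl] unfolding left_inv_def by (blast intro: pi_form path_in_ty app_arrow)
qed

lemma sig_inv_ty:
  assumes wf: "wf_ctx R \<Gamma>" and X: "R \<turnstile> \<Gamma> \<rhd> IsTy Large X" and Y: "R \<turnstile> \<Gamma> \<rhd> IsTy Large Y"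
    and f: "R \<turnstile> \<Gamma> \<rhd> HasTm f (Arrow X Y)"
  shows "R \<turnstile> \<Gamma> \<rhd> IsTy Large (Sig (Arrow Y X) (right_inv Y f))"
    and "R \<turnstile> CTm (Sig (Arrow Y X) (right_inv Y f)) # \<Gamma> \<rhd> IsTy Large (wk 1 (Sig (Arrow Y X) (left_inv X f)))"
proof -
  show r: "R \<turnstile> \<Gamma> \<rhd> IsTy Large (Sig (Arrow Y X) (right_inv Y f))"
    by (rule sig_form[OF arrow_ty(1)[OF wf Y X] inv_ty(1)[OF assms]])
  have "R \<turnstile> \<Gamma> \<rhd> IsTy Large (Sig (Arrow Y X) (left_inv X f))"
    by (rule sig_form[OF arrow_ty(1)[OF wf Y X] inv_ty(2)[OF assms]])
  from weaken[OF ctx_tm[OF wf r] this]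
  show "R \<turnstile> CTm (Sig (Arrow Y X) (right_inv Y f)) # \<Gamma> \<rhd> IsTy Large (wk 1 (Sig (Arrow Y X) (left_inv X f)))"
    by (simp add: ren_eq_tsubst)
qed

lemma is_equiv_eq: "IsEquiv X Y f = Sig (Sig (Arrow Y X) (right_inv Y f)) (wk 1 (Sig (Arrow Y X) (left_inv X f)))"
  by (simp add: IsEquiv_def Prod_def right_inv_def left_inv_def)

lemma is_equiv_subst: "tsubst \<sigma> (IsEquiv X Y f) = IsEquiv (tsubst \<sigma> X) (tsubst \<sigma> Y) (tsubst \<sigma> f)"
  by (simp add: IsEquiv_def Prod_def Arrow_def PathIn_def subst_simps)

text \<open>The path constant at the variable of type \<open>Z\<close> also starts at
  \<open>t\<close>, because endpoints matter only up to judgmental equality. Its body is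
  \<open>Var 1\<close>, as \<open>Var 0\<close> is the path variable.\<close>

lemma refl_path:
  assumes wf: "wf_ctx R \<Gamma>" and Z: "R \<turnstile> \<Gamma> \<rhd> IsTy Large Z" and t: "R \<turnstile> CTm Z # \<Gamma> \<rhd> EqTm t (Var 0) (wk 1 Z)"
  shows "R \<turnstile> \<Gamma> \<rhd> HasTm (Lam (PLam (Var 1))) (Pi Z (PathIn (wk 1 Z) t (Var 0)))"
proof (rule lam[OF Z], unfold PathIn_def, rule plam)
  have c: "wf_ctx R (CTm Z # \<Gamma>)" by (rule ctx_tm[OF wf Z])
  show "R \<turnstile> CPath # CTm Z # \<Gamma> \<rhd> HasTm (Var 1) (wk 1 (wk 1 Z))"
    using variable[OF ctx_path[OF c], of 1] by (simp add: subst_simps)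
  show "R \<turnstile> CTm Z # \<Gamma> \<rhd> EqTm (inst (Var 1) (PEnd E0)) t (inst (wk 1 (wk 1 Z)) (PEnd E0))"
    using tm_sym[OF t] by (simp add: subst_simps)
  show "R \<turnstile> CTm Z # \<Gamma> \<rhd> EqTm (inst (Var 1) (PEnd E1)) (Var 0) (inst (wk 1 (wk 1 Z)) (PEnd E1))"
    using tm_refl[OF variable_0[OF c]] by (simp add: subst_simps)
qed

text \<open>The hypothesis relates the bodies directly, since two \<beta>-steps leave
  \<open>M\<close> with \<open>N\<close> substituted. Both composites of an isomorphism are
  instances, with \<open>M\<close> and \<open>N\<close> exchanged.\<close>

lemma app_lam_lam:
  assumes wf: "wf_ctx R \<Gamma>" and X: "R \<turnstile> \<Gamma> \<rhd> IsTy Large X" and Y: "R \<turnstile> \<Gamma> \<rhd> IsTy Large Y"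
    and M: "R \<turnstile> CTm X # \<Gamma> \<rhd> HasTm M (wk 1 Y)" and N: "R \<turnstile> CTm Y # \<Gamma> \<rhd> HasTm N (wk 1 X)"
    and MN: "R \<turnstile> CTm Y # \<Gamma> \<rhd> EqTm (tsubst (N .: (\<lambda>n. Var (Suc n))) M) (Var 0) (wk 1 Y)"
  shows "R \<turnstile> CTm Y # \<Gamma> \<rhd> EqTm (App (wk 1 (Lam M)) (App (wk 1 (Lam N)) (Var 0))) (Var 0) (wk 1 Y)"
proof -
  let ?s = "\<lambda>n. Var (Suc n)"
  have c: "wf_ctx R (CTm Y # \<Gamma>)" by (rule ctx_tm[OF wf Y])
  have X': "R \<turnstile> CTm Y # \<Gamma> \<rhd> IsTy Large (tsubst ?s X)" using weaken[OF c X] by simp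
  have M': "R \<turnstile> CTm (tsubst ?s X) # CTm Y # \<Gamma> \<rhd> HasTm (tsubst (up ?s) M) (tsubst (up ?s) (wk 1 Y))"
    using substitution[OF wf_sub_up_tm[OF wf_sub_shift[OF c] X] M] by simp
  have N': "R \<turnstile> CTm Y # \<Gamma> \<rhd> EqTm (App (wk 1 (Lam N)) (Var 0)) N (tsubst ?s X)"
    using pi_beta_var[OF c Y N] by (simp add: ren_eq_tsubst)
  have "R \<turnstile> CTm Y # \<Gamma> \<rhd> EqTm (App (wk 1 (Lam M)) (App (wk 1 (Lam N)) (Var 0))) (App (wk 1 (Lam M)) N) (wk 1 Y)"
    using app_eq[OF tm_refl[OF lam[OF X' M']] N'] by (simp add: subst_simps)
  moreover have "R \<turnstile> CTm Y # \<Gamma> \<rhd> EqTm (App (wk 1 (Lam M)) N) (tsubst (N .: ?s) M) (wk 1 Y)"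
    using pi_beta[OF X' M' N[unfolded ren_eq_tsubst, simplified]] by (simp add: subst_simps)
  ultimately show ?thesis using MN by (blast intro: tm_trans)
qed

text \<open>As both homotopies are constant, the same term \<open>Tup ?g ?r\<close> serves as right
  and as left inverse data; only its type differs.\<close>

lemma equiv_of_iso:
  assumes wf: "wf_ctx R \<Gamma>" and X: "R \<turnstile> \<Gamma> \<rhd> IsTy Large X" and Y: "R \<turnstile> \<Gamma> \<rhd> IsTy Large Y"
    and M: "R \<turnstile> CTm X # \<Gamma> \<rhd> HasTm M (wk 1 Y)" and N: "R \<turnstile> CTm Y # \<Gamma> \<rhd> HasTm N (wk 1 X)"
    and MN: "R \<turnstile> CTm Y # \<Gamma> \<rhd> EqTm (tsubst (N .: (\<lambda>n. Var (Suc n))) M) (Var 0) (wk 1 Y)"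
    and NM: "R \<turnstile> CTm X # \<Gamma> \<rhd> EqTm (tsubst (M .: (\<lambda>n. Var (Suc n))) N) (Var 0) (wk 1 X)"
  shows "\<exists>E. R \<turnstile> \<Gamma> \<rhd> HasTm E (Equiv X Y)"
proof -
  let ?f = "Lam M" and ?g = "Lam N" and ?r = "Lam (PLam (Var 1))"
  have f: "R \<turnstile> \<Gamma> \<rhd> HasTm ?f (Arrow X Y)" and g: "R \<turnstile> \<Gamma> \<rhd> HasTm ?g (Arrow Y X)"
    unfolding Arrow_def by (rule lam[OF X M], rule lam[OF Y N])
  have "R \<turnstile> \<Gamma> \<rhd> HasTm ?r (inst (right_inv Y ?f) ?g)"
    using refl_path[OF wf Y app_lam_lam[OF wf X Y M N MN]]
    by (simp add: right_inv_def PathIn_def subst_simps)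
  then have r: "R \<turnstile> \<Gamma> \<rhd> HasTm (Tup ?g ?r) (Sig (Arrow Y X) (right_inv Y ?f))"
    by (rule pair[OF inv_ty(1)[OF wf X Y f] g])
  have "R \<turnstile> \<Gamma> \<rhd> HasTm ?r (inst (left_inv X ?f) ?g)"
    using refl_path[OF wf X app_lam_lam[OF wf Y X N M NM]]
    by (simp add: left_inv_def PathIn_def subst_simps)
  then have "R \<turnstile> \<Gamma> \<rhd> HasTm (Tup ?g ?r) (Sig (Arrow Y X) (left_inv X ?f))"
    by (rule pair[OF inv_ty(2)[OF wf X Y f] g])
  then have l: "R \<turnstile> \<Gamma> \<rhd> HasTm (Tup ?g ?r) (inst (wk 1 (Sig (Arrow Y X) (left_inv X ?f))) (Tup ?g ?r))"
    by (simp only: inst_wk)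
  have "R \<turnstile> \<Gamma> \<rhd> HasTm (Tup (Tup ?g ?r) (Tup ?g ?r)) (IsEquiv X Y ?f)"
    unfolding is_equiv_eq by (rule pair[OF sig_inv_ty(2)[OF wf X Y f] r l])
  then have e: "R \<turnstile> \<Gamma> \<rhd> HasTm (Tup (Tup ?g ?r) (Tup ?g ?r)) (inst (IsEquiv (wk 1 X) (wk 1 Y) (Var 0)) ?f)"
    by (simp add: inst_def is_equiv_subst ren_eq_tsubst)
  let ?\<Gamma> = "CTm (Arrow X Y) # \<Gamma>"
  note c = arrow_ty(2)[OF wf X Y]
  have X': "R \<turnstile> ?\<Gamma> \<rhd> IsTy Large (wk 1 X)" and Y': "R \<turnstile> ?\<Gamma> \<rhd> IsTy Large (wk 1 Y)"
    using weaken[OF c X] weaken[OF c Y] by (simp_all add: ren_eq_tsubst)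
  have f': "R \<turnstile> ?\<Gamma> \<rhd> HasTm (Var 0) (Arrow (wk 1 X) (wk 1 Y))"
    using variable_0[OF c] by (simp add: Arrow_def subst_simps)
  have "R \<turnstile> ?\<Gamma> \<rhd> IsTy Large (IsEquiv (wk 1 X) (wk 1 Y) (Var 0))"
    unfolding is_equiv_eq by (rule sig_form[OF sig_inv_ty[OF c X' Y' f']])
  from pair[OF this f e] show ?thesis unfolding Equiv_def ..
qed

theorem theorem6p4:
  fixes R :: "(('c ctx \<times> 'c jdg) set \<times> 'c ctx \<times> 'c jdg) set"
    and \<Gamma> :: "'c ctx" and A B F F' :: "'c tm"
  assumes "wf_ctx R \<Gamma>"
    and "R \<turnstile> CBridge # \<Gamma> \<rhd> IsTy Large A"
    and "R \<turnstile> CTm A # CBridge # \<Gamma> \<rhd> IsTy Large B"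
    and "R \<turnstile> \<Gamma> \<rhd> HasTm F (Pi (inst A (BEnd E0)) (inst_under B (BEnd E0)))"
    and "R \<turnstile> \<Gamma> \<rhd> HasTm F' (Pi (inst A (BEnd E1)) (inst_under B (BEnd E1)))"
  shows "\<exists>E. R \<turnstile> \<Gamma> \<rhd> HasTm E
    (Equiv
      (Bridge (Pi A B) F F')
      (Pi (inst A (BEnd E0))
        (Pi (wk 1 (inst A (BEnd E1)))
          (Pi (edge A)
            (Bridge (along B) (App (wk 3 F) (Var 2)) (App (wk 3 F') (Var 1)))))))"
proof -
  let ?X = "Bridge (Pi A B) F F'" and ?Y = "rel_ty A B F F'"
  let ?s = "\<lambda>n. Var (Suc n)"
  let ?A = "tsubst (up ?s) A" and ?B = "tsubst (up (up ?s)) B" and ?F = "tsubst ?s F" and ?F' = "tsubst ?s F'"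
  have d: "pi_data R \<Gamma> A B F F'" using assms by (simp add: pi_data_def)
  have X: "R \<turnstile> \<Gamma> \<rhd> IsTy Large ?X" by (rule pi_ty[OF d])
  have Y: "R \<turnstile> \<Gamma> \<rhd> IsTy Large ?Y" by (rule rel_ty_ty[OF d])
  note cX = ctx_tm[OF assms(1) X] and cY = ctx_tm[OF assms(1) Y]
  have X': "wk 1 ?X = Bridge (Pi ?A ?B) ?F ?F'" by (simp add: subst_simps)
  have Y': "wk 1 ?Y = rel_ty ?A ?B ?F ?F'" by (simp add: ren_eq_tsubst rel_ty_subst)
  \<comment> \<open>The composites are needed at a variable of type \<open>?X\<close> or
    \<open>?Y\<close>, so the data are weakened into the context with that variable;
    \<open>X'\<close> and \<open>Y'\<close> identify the weakened types with the types built from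
    the weakened data.\<close>
  note dX = pi_data_subst[OF d wf_sub_shift[OF cX]] and dY = pi_data_subst[OF d wf_sub_shift[OF cY]]
  note x = variable_0[OF cX, unfolded X'] and y = variable_0[OF cY, unfolded Y']
  have "R \<turnstile> CTm ?X # \<Gamma> \<rhd> HasTm (fwd (Var 0)) (wk 1 ?Y)"
    unfolding Y' by (rule fwd_ty[OF dX x])
  moreover have "R \<turnstile> CTm ?Y # \<Gamma> \<rhd> HasTm (bwd ?F ?F' (Var 0)) (wk 1 ?X)"
    unfolding X' by (rule bwd_ty[OF dY y])
  moreover have "R \<turnstile> CTm ?Y # \<Gamma> \<rhd> EqTm (tsubst (bwd ?F ?F' (Var 0) .: ?s) (fwd (Var 0))) (Var 0) (wk 1 ?Y)"
    unfolding Y' fwd_subst using fwd_bwd[OF dY y] by simp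
  moreover have "R \<turnstile> CTm ?X # \<Gamma> \<rhd> EqTm (tsubst (fwd (Var 0) .: ?s) (bwd ?F ?F' (Var 0))) (Var 0) (wk 1 ?X)"
    unfolding X' bwd_subst using bwd_fwd[OF dX x] by simp
  ultimately have "\<exists>E. R \<turnstile> \<Gamma> \<rhd> HasTm E (Equiv ?X ?Y)"
    by (rule equiv_of_iso[OF assms(1) X Y])
  then show ?thesis by (simp add: rel_ty_def rel_body_def)
qed

end
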